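(* Let $\alpha>1$ and $\mu\in\mathbb{R}$. Let $\phi\le\mu$ be an even, $2\pi$-periodic solution of $$\tfrac12(\mu-\phi)^2=\tfrac12\mu^2-L\phi,$$ which is nonincreasing on $[0,\pi]$, and attains its maximum at $\phi(0)=\mu$. Then $\phi$ cannot belong to the class $C^1(\mathbb{T})$.
   Context: $\mathbb{T}=[-\pi,\pi]$, and functions on $\mathbb{T}$ are identified with $2\pi$-periodic functions on $\mathbb{R}$, so $C^1(\mathbb{T})$ is the space of $2\pi$-periodic $C^1$ functions. $L$ is the Fourier multiplier operator with symbol $m(\xi)=(1+\xi^2)^{-\alpha/2}$: $Lf=K*f$ with $K=\mathcal{F}^{-1}(m)$, i.e. $K(x)=\frac1{2\pi}\int_{\mathbb{R}}m(\xi)e^{ix\xi}\,d\xi$; on $2\pi$-periodic functions it multiplies the $n$-th Fourier coefficient by $m(n)$. A solution is a real-valued bounded function satisfying the equation pointwise.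
   Formalization: The formal theorem additionally assumes that φ is not constant; without this the claim is false, since the constant solutions φ = μ = 0 and φ = μ = 2 satisfy every hypothesis and are C¹. *)

theory Defs
  imports "HOL-Analysis.Analysis"
begin

definition symb :: "real \<Rightarrow> real \<Rightarrow> real" where
  "symb \<alpha> \<xi> = (1 + \<xi>\<^sup>2) powr (- \<alpha> / 2)"

definition inverse_fourier :: "(real \<Rightarrow> complex) \<Rightarrow> real \<Rightarrow> complex" where
  "inverse_fourier g x =
     1 / (2 * of_real pi) * (LINT \<xi>|lborel. g \<xi> * exp (\<i> * of_real (x * \<xi>)))"

definition convolution :: "(real \<Rightarrow> complex) \<Rightarrow> (real \<Rightarrow> complex) \<Rightarrow> real \<Rightarrow> complex" where
  "convolution k f x = (LINT y|lborel. k (x - y) * f y)"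

(* For \<alpha> > 1 the symbol is integrable, so the kernel is given by an absolutely convergent
   integral. The kernel is integrable too, so the convolution defining L converges absolutely
   at every point for every bounded measurable f. *)
definition kern :: "real \<Rightarrow> real \<Rightarrow> complex" where
  "kern \<alpha> = inverse_fourier (\<lambda>\<xi>. of_real (symb \<alpha> \<xi>))"

definition L :: "real \<Rightarrow> (real \<Rightarrow> complex) \<Rightarrow> real \<Rightarrow> complex" where
  "L \<alpha> f = convolution (kern \<alpha>) f"

(* L is complex-valued by definition, so the equation for a real function is stated in the
   complex numbers; this includes that L applied to the function is real. *)
definition is_solution :: "real \<Rightarrow> real \<Rightarrow> (real \<Rightarrow> real) \<Rightarrow> bool" where
  "is_solution \<alpha> \<mu> \<phi> \<longleftrightarrow> bounded (range \<phi>) \<and>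
     (\<forall>x. of_real (1/2 * (\<mu> - \<phi> x)\<^sup>2) =
          of_real (1/2 * \<mu>\<^sup>2) - L \<alpha> (\<lambda>y. of_real (\<phi> y)) x)"

definition periodic_2pi :: "(real \<Rightarrow> real) \<Rightarrow> bool" where
  "periodic_2pi f \<longleftrightarrow> (\<forall>x. f (x + 2 * pi) = f x)"

definition C1_torus :: "(real \<Rightarrow> real) set" where
  "C1_torus = {f. periodic_2pi f \<and> f C1_differentiable_on UNIV}"

end

theory Submission
  imports Defs "HOL-Probability.Characteristic_Functions"
begin

text \<open>
  Put \<open>u = \<mu> - \<phi> \<ge> 0\<close>. Since \<open>u 0 = 0\<close>, the equation gives
  \<open>u(x)\<^sup>2 = 2 (L\<phi>(0) - L\<phi>(x))\<close>. If \<open>\<phi>\<close> were \<open>C\<^sup>1\<close>, then \<open>u'(0) = 0\<close> and the left-hand side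
  would be \<open>o(x\<^sup>2)\<close>, whereas the right-hand side is at least of order \<open>x\<^sup>2\<close>. For the latter, fix an
  integer \<open>N > \<alpha>/2\<close> and integrate in \<open>s\<close>:
  \<open>(1 + n\<^sup>2)\<^bsup>-\<alpha>/2\<^esup> = c \<integral> s\<^bsup>N-\<alpha>/2-1\<^esup> (1 + s + n\<^sup>2)\<^bsup>-N\<^esup> ds\<close>, so that on even periodic functions \<open>L\<close> is a positive
  mixture of the powers \<open>(1 + s - d\<^sup>2/dx\<^sup>2)\<^bsup>-N\<^esup>\<close> of Neumann resolvents on \<open>[0,\<pi>]\<close>. By the
  maximum principle each resolvent preserves nonincreasing functions, and the image of a nonconstant
  one has negative second derivative at \<open>0\<close>. Fatou's lemma in \<open>s\<close> concludes.

  The mixture formula is checked on \<open>cos (n x)\<close> and extended by density of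
  trigonometric polynomials; this only needs that the kernel is integrable with Fourier transform
  the symbol, which follows by writing the symbol as a mixture of Gaussians.
\<close>

section \<open>The kernel as a mixture of Gaussians\<close>

lemma gaussian_fourier_std:
  "(LINT z|lborel. of_real (exp (- z\<^sup>2 / 2)) * exp (\<i> * of_real (w * z)))
     = complex_of_real (sqrt (2 * pi) * exp (- w\<^sup>2 / 2))"
proof -
  have "char std_normal_distribution w = (LINT z|lborel. std_normal_density z *\<^sub>R iexp (w * z))"
    unfolding char_def by (subst integral_density) auto
  also have "\<dots> = (LINT z|lborel. of_real (1 / sqrt (2 * pi)) *
      (of_real (exp (- z\<^sup>2 / 2)) * exp (\<i> * of_real (w * z))))"
    by (intro Bochner_Integration.integral_cong refl)
       (simp add: std_normal_density_def scaleR_conv_of_real)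
  also have "\<dots> = of_real (1 / sqrt (2 * pi)) *
      (LINT z|lborel. of_real (exp (- z\<^sup>2 / 2)) * exp (\<i> * of_real (w * z)))"
    by (rule integral_mult_right_zero)
  finally show ?thesis
    by (simp add: char_std_normal_distribution field_simps)
qed

lemma gaussian_integrable:
  assumes t: "t > 0"
  shows "integrable lborel (\<lambda>z::real. exp (- t * z\<^sup>2))"
proof -
  have "integrable lborel (\<lambda>z. sqrt (2 * pi) * std_normal_density z)"
    by (intro integrable_mult_right) simp
  then have "integrable lborel (\<lambda>z. exp (- (z\<^sup>2) / 2) :: real)"
    by (simp add: std_normal_density_def)
  from lborel_integrable_real_affine[OF this, of "sqrt (2 * t)" 0] t
  show ?thesis by (simp add: power_mult_distrib)
qed

lemma gaussian_fourier:
  assumes t: "t > 0"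
  shows "(LINT z|lborel. of_real (exp (- t * z\<^sup>2)) * exp (\<i> * of_real (w * z)))
     = complex_of_real (sqrt (pi / t) * exp (- w\<^sup>2 / (4 * t)))"
proof -
  \<comment> \<open>Scaling by this factor turns exp (- z^2 / 2) into exp (- t z^2), reducing the
    claim to the standard Gaussian.\<close>
  let ?r = "sqrt (2 * t)"
  have r: "?r > 0" "?r\<^sup>2 = 2 * t" using t by auto
  have "complex_of_real (sqrt (2 * pi) * exp (- (w / ?r)\<^sup>2 / 2))
    = \<bar>?r\<bar> *\<^sub>R (LINT z|lborel. of_real (exp (- (0 + ?r * z)\<^sup>2 / 2)) * exp (\<i> * of_real (w / ?r * (0 + ?r * z))))"
    unfolding gaussian_fourier_std[symmetric]
    by (rule lborel_integral_real_affine) (use r in simp)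
  also have "\<dots> = of_real ?r * (LINT z|lborel. of_real (exp (- t * z\<^sup>2)) * exp (\<i> * of_real (w * z)))"
    using r by (simp add: scaleR_conv_of_real power_mult_distrib)
  finally have "(LINT z|lborel. of_real (exp (- t * z\<^sup>2)) * exp (\<i> * of_real (w * z)))
     = complex_of_real (sqrt (2 * pi) / ?r * exp (- (w / ?r)\<^sup>2 / 2))"
    using r(1) by (simp add: field_simps)
  also have "sqrt (2 * pi) / ?r = sqrt (pi / t)"
    by (simp add: real_sqrt_divide real_sqrt_mult)
  also have "- (w / ?r)\<^sup>2 / 2 = - w\<^sup>2 / (4 * t)" using r by (simp add: power_divide)
  finally show ?thesis by simp
qed

lemma gaussian_integral:
  assumes t: "t > 0"
  shows "(LINT z|lborel. exp (- t * z\<^sup>2)) = sqrt (pi / t)"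
proof -
  have "complex_of_real (LINT z|lborel. exp (- t * z\<^sup>2)) = of_real (sqrt (pi / t))"
    using gaussian_fourier[OF t, of 0] by simp
  then show ?thesis by (simp only: of_real_eq_iff)
qed

text \<open>Substitute t -> l t in Euler's integral for Gamma. With a nonnegative integral,
  integrability can later be read off from the finite value.\<close>

lemma nn_integral_powr_exp:
  fixes b l :: real
  assumes b: "b > 0" and l: "l > 0"
  shows "(\<integral>\<^sup>+t. ennreal (indicator {0<..} t * t powr (b - 1) * exp (- l * t)) \<partial>lborel)
    = ennreal (Gamma b * l powr (- b))"
proof -
  have "ennreal (Gamma b) = (\<integral>\<^sup>+t. ennreal (indicator {0..} t * t powr (b - 1) / exp t) \<partial>lborel)"
    by (rule Gamma_conv_nn_integral_real[OF b])
  also have "\<dots> = \<bar>l\<bar> * (\<integral>\<^sup>+t. ennreal (indicator {0..} (0 + l * t) * (0 + l * t) powr (b - 1) / exp (0 + l * t)) \<partial>lborel)"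
    by (rule nn_integral_real_affine) (use l in auto)
  also have "\<dots> = (\<integral>\<^sup>+t. ennreal l * ennreal (indicator {0..} (0 + l * t) * (0 + l * t) powr (b - 1) / exp (0 + l * t)) \<partial>lborel)"
    using l by (subst nn_integral_cmult) auto
  also have "\<dots> = (\<integral>\<^sup>+t. ennreal (l powr b) * ennreal (indicator {0<..} t * t powr (b - 1) * exp (- l * t)) \<partial>lborel)"
  proof (intro nn_integral_cong)
    fix t :: real
    have "l * (indicator {0..} (0 + l * t) * (0 + l * t) powr (b - 1) / exp (0 + l * t)) =
       l powr b * (indicator {0<..} t * t powr (b - 1) * exp (- l * t))"
    proof (cases "t > 0")
      case True
      moreover have "l * (l powr (b - 1)) = l powr b" using l by (simp add: powr_diff)
      ultimately show ?thesis using l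
        by (simp add: powr_mult exp_minus divide_simps)
    next
      \<comment> \<open>At t = 0 the two indicators differ, but both integrands vanish there because
        \<open>0 powr r\<close> is 0.\<close>
      case False
      then show ?thesis using l by (auto simp: indicator_def zero_le_mult_iff)
    qed
    then show "ennreal l * ennreal (indicator {0..} (0 + l * t) * (0 + l * t) powr (b - 1) / exp (0 + l * t)) =
       ennreal (l powr b) * ennreal (indicator {0<..} t * t powr (b - 1) * exp (- l * t))"
      using l by (metis (no_types, lifting) ennreal_mult' less_imp_le powr_ge_zero)
  qed
  also have "\<dots> = ennreal (l powr b) * (\<integral>\<^sup>+t. ennreal (indicator {0<..} t * t powr (b - 1) * exp (- l * t)) \<partial>lborel)"
    by (rule nn_integral_cmult) simp
  finally have "ennreal (l powr (- b)) * ennreal (Gamma b) =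
     ennreal (l powr (- b)) * ennreal (l powr b) * (\<integral>\<^sup>+t. ennreal (indicator {0<..} t * t powr (b - 1) * exp (- l * t)) \<partial>lborel)"
    by (simp add: mult.assoc)
  also have "ennreal (l powr (- b)) * ennreal (l powr b) = 1"
    using l by (simp add: ennreal_mult'[symmetric] powr_add[symmetric])
  finally show ?thesis
    using b by (simp add: ennreal_mult[symmetric] mult.commute Gamma_real_pos less_imp_le)
qed

lemma has_bochner_integral_powr_exp:
  fixes b l :: real
  assumes b: "b > 0" and l: "l > 0"
  shows "has_bochner_integral lborel (\<lambda>t. indicator {0<..} t * t powr (b - 1) * exp (- l * t)) (Gamma b * l powr (- b))"
  by (rule has_bochner_integral_nn_integral[OF _ _ _ nn_integral_powr_exp[OF assms]])
     (use b in \<open>auto simp: Gamma_real_pos less_imp_le\<close>)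

text \<open>The density of the Gamma distribution with shape \<alpha>/2 and rate 1; its Laplace
  transform at \<xi>^2 is the symbol.\<close>

definition gauss_weight :: "real \<Rightarrow> real \<Rightarrow> real" where
  "gauss_weight \<alpha> t = indicator {0<..} t * t powr (\<alpha> / 2 - 1) * exp (- t) / Gamma (\<alpha> / 2)"

lemma gauss_weight_nonneg: "\<alpha> > 0 \<Longrightarrow> gauss_weight \<alpha> t \<ge> 0"
  by (simp add: gauss_weight_def Gamma_real_pos less_imp_le)

lemma gauss_weight_measurable [measurable]: "gauss_weight \<alpha> \<in> borel_measurable borel"
  unfolding gauss_weight_def by measurable

lemma has_bochner_integral_gauss_weight:
  assumes "\<alpha> > 0"
  shows "has_bochner_integral lborel (\<lambda>t. gauss_weight \<alpha> t * exp (- t * \<xi>\<^sup>2)) (symb \<alpha> \<xi>)"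
proof -
  have "1 + \<xi>\<^sup>2 > 0" by (simp add: add_pos_nonneg)
  have G: "Gamma (\<alpha> / 2) > 0" using assms by simp
  have 1: "has_bochner_integral lborel (\<lambda>t. 1 / Gamma (\<alpha> / 2) *
      (indicator {0<..} t * t powr (\<alpha> / 2 - 1) * exp (- (1 + \<xi>\<^sup>2) * t)))
      (1 / Gamma (\<alpha> / 2) * (Gamma (\<alpha> / 2) * (1 + \<xi>\<^sup>2) powr - (\<alpha> / 2)))"
    by (intro has_bochner_integral_mult_right has_bochner_integral_powr_exp)
       (use assms \<open>1 + \<xi>\<^sup>2 > 0\<close> in auto)
  have "1 / Gamma (\<alpha> / 2) * (indicator {0<..} t * t powr (\<alpha> / 2 - 1) * exp (- (1 + \<xi>\<^sup>2) * t))
      = gauss_weight \<alpha> t * exp (- t * \<xi>\<^sup>2)" for t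
  proof -
    have "exp (- (1 + \<xi>\<^sup>2) * t) = exp (- t) * exp (- t * \<xi>\<^sup>2)"
      by (simp add: exp_add[symmetric] algebra_simps)
    then show ?thesis by (simp only: gauss_weight_def) simp
  qed
  moreover have "1 / Gamma (\<alpha> / 2) * (Gamma (\<alpha> / 2) * (1 + \<xi>\<^sup>2) powr - (\<alpha> / 2)) = symb \<alpha> \<xi>"
    using G by (simp add: symb_def)
  ultimately show ?thesis using 1 by simp
qed

lemma gauss_weight_integrable:
  assumes "\<alpha> > 0"
  shows "integrable lborel (gauss_weight \<alpha>)"
  using has_bochner_integral_gauss_weight[OF assms, of 0] by (simp add: has_bochner_integral_iff)

text \<open>Integrating exp (- t z^2) over z gives sqrt (pi / t), so this is the absolute
  integrability that Fubini asks for in \<open>kern_eq\<close>. The factor t^(-1/2) lowers the Gamma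
  exponent to (\<alpha> - 1)/2, which is positive because \<alpha> > 1.\<close>

lemma gauss_weight_sqrt_integrable:
  assumes "\<alpha> > 1"
  shows "integrable lborel (\<lambda>t. gauss_weight \<alpha> t * sqrt (pi / t))"
proof -
  have "has_bochner_integral lborel (\<lambda>t. sqrt pi / Gamma (\<alpha> / 2) *
      (indicator {0<..} t * t powr ((\<alpha> / 2 - 1 / 2) - 1) * exp (- 1 * t)))
      (sqrt pi / Gamma (\<alpha> / 2) * (Gamma (\<alpha> / 2 - 1 / 2) * 1 powr - (\<alpha> / 2 - 1 / 2)))"
    by (intro has_bochner_integral_mult_right has_bochner_integral_powr_exp)
       (use assms in auto)
  moreover have "sqrt pi / Gamma (\<alpha> / 2) * (indicator {0<..} t * t powr ((\<alpha> / 2 - 1 / 2) - 1) * exp (- 1 * t))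
     = gauss_weight \<alpha> t * sqrt (pi / t)" for t
  proof (cases "t > 0")
    case True
    have "t powr ((\<alpha> / 2 - 1 / 2) - 1) = t powr ((\<alpha> / 2 - 1) - 1 / 2)"
      by (rule arg_cong[of _ _ "(powr) t"]) simp
    also have "\<dots> = t powr (\<alpha> / 2 - 1) / sqrt t"
      using True by (simp only: powr_diff) (simp add: powr_half_sqrt)
    finally show ?thesis using True by (simp add: gauss_weight_def real_sqrt_divide)
  qed (simp add: gauss_weight_def)
  ultimately show ?thesis by (simp add: has_bochner_integral_iff)
qed

text \<open>The inverse transform taken under the mixture: for t > 0 the Gaussian exp (- t \<xi>^2)
  becomes the centred normal density of variance 2t.\<close>

definition kern_real :: "real \<Rightarrow> real \<Rightarrow> real" where
  "kern_real \<alpha> x = (LINT t|lborel. gauss_weight \<alpha> t * (sqrt (pi / t) * exp (- x\<^sup>2 / (4 * t)) / (2 * pi)))"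

lemma kern_eq:
  assumes a: "\<alpha> > 1"
  shows "kern \<alpha> x = complex_of_real (kern_real \<alpha> x)"
proof -
  define F where "F = (\<lambda>t \<xi>. of_real (gauss_weight \<alpha> t) * (of_real (exp (- t * \<xi>\<^sup>2)) * exp (\<i> * of_real (x * \<xi>))) :: complex)"
  have inner: "integrable lborel (F t)" for t
  proof (cases "t > 0")
    case True
    have "integrable lborel (\<lambda>\<xi>. of_real (exp (- t * \<xi>\<^sup>2)) * exp (\<i> * of_real (x * \<xi>)) :: complex)"
      by (rule Bochner_Integration.integrable_bound[OF gaussian_integrable[OF True]]) (auto simp: norm_mult)
    then show ?thesis unfolding F_def by (rule integrable_mult_right)
  qed (simp add: F_def gauss_weight_def)
  have int: "integrable (lborel \<Otimes>\<^sub>M lborel) (case_prod F)"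
  proof (rule lborel_pair.Fubini_integrable)
    show "case_prod F \<in> borel_measurable (lborel \<Otimes>\<^sub>M lborel)" unfolding F_def by measurable
    have "(\<integral>\<xi>. norm (F t \<xi>) \<partial>lborel) = gauss_weight \<alpha> t * sqrt (pi / t)" for t
    proof (cases "t > 0")
      case True
      have "(\<integral>\<xi>. norm (F t \<xi>) \<partial>lborel) = gauss_weight \<alpha> t * (\<integral>\<xi>. exp (- t * \<xi>\<^sup>2) \<partial>lborel)"
        using a by (simp add: F_def norm_mult abs_of_nonneg gauss_weight_nonneg)
      then show ?thesis by (simp only: gaussian_integral[OF True])
    qed (simp add: F_def gauss_weight_def)
    then show "integrable lborel (\<lambda>t. \<integral>\<xi>. norm (case_prod F (t, \<xi>)) \<partial>lborel)"
      using gauss_weight_sqrt_integrable[OF a] by simp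
    show "AE t in lborel. integrable lborel (\<lambda>\<xi>. case_prod F (t, \<xi>))"
      using inner by simp
  qed
  have 1: "(\<integral>\<xi>. (\<integral>t. F t \<xi> \<partial>lborel) \<partial>lborel) = (\<integral>t. (\<integral>\<xi>. F t \<xi> \<partial>lborel) \<partial>lborel)"
    by (rule lborel_pair.Fubini_integral[OF int])
  have 2: "(\<integral>t. F t \<xi> \<partial>lborel) = of_real (symb \<alpha> \<xi>) * exp (\<i> * of_real (x * \<xi>))" for \<xi>
  proof -
    have "(\<integral>t. F t \<xi> \<partial>lborel) = (\<integral>t. of_real (gauss_weight \<alpha> t * exp (- t * \<xi>\<^sup>2)) * exp (\<i> * of_real (x * \<xi>)) \<partial>lborel)"
      by (simp add: F_def mult.assoc)
    also have "\<dots> = of_real (symb \<alpha> \<xi>) * exp (\<i> * of_real (x * \<xi>))"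
      using has_bochner_integral_gauss_weight[of \<alpha> \<xi>] a
      by (simp add: has_bochner_integral_iff del: of_real_mult)
    finally show ?thesis .
  qed
  have 3: "(\<integral>\<xi>. F t \<xi> \<partial>lborel) = of_real (gauss_weight \<alpha> t * (sqrt (pi / t) * exp (- x\<^sup>2 / (4 * t))))" for t
  proof (cases "t > 0")
    case True
    then show ?thesis unfolding F_def integral_mult_right_zero gaussian_fourier[OF True] by simp
  qed (simp add: F_def gauss_weight_def)
  have "kern \<alpha> x = 1 / (2 * of_real pi) * of_real (\<integral>t. gauss_weight \<alpha> t * (sqrt (pi / t) * exp (- x\<^sup>2 / (4 * t))) \<partial>lborel)"
    using 1 unfolding kern_def inverse_fourier_def 2 3 by (simp del: of_real_mult)
  moreover have "kern_real \<alpha> x = 1 / (2 * pi) * (\<integral>t. gauss_weight \<alpha> t * (sqrt (pi / t) * exp (- x\<^sup>2 / (4 * t))) \<partial>lborel)"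
    unfolding kern_real_def integral_mult_right_zero[symmetric] by (simp add: mult_ac)
  ultimately show ?thesis by simp
qed


text \<open>Fourier inversion for this kernel is again Fubini: every normal density in the mixture
  has mass 1, so the absolute integral is that of \<open>gauss_weight\<close>, and each density
  transforms to exp (- t w^2). The case w = 0 gives integrability of the kernel.\<close>

lemma kern_real_fourier:
  assumes a: "\<alpha> > 1"
  shows "integrable lborel (\<lambda>y. of_real (kern_real \<alpha> y) * exp (\<i> * of_real (w * y)))" (is ?I)
    and "(LINT y|lborel. of_real (kern_real \<alpha> y) * exp (\<i> * of_real (w * y))) = complex_of_real (symb \<alpha> w)"
      (is ?E)
proof -
  define h where "h = (\<lambda>t. gauss_weight \<alpha> t * sqrt (pi / t) / (2 * pi))"
  have hm[measurable]: "h \<in> borel_measurable borel" unfolding h_def by measurable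
  define F where "F = (\<lambda>t y. of_real (h t) * (of_real (exp (- (1 / (4 * t)) * y\<^sup>2)) * exp (\<i> * of_real (w * y))) :: complex)"
  have h0: "h t = 0" if "t \<le> 0" for t using that by (simp add: h_def gauss_weight_def)
  \<comment> \<open>\<open>h\<close> absorbs the normalisation: times the mass sqrt (4 pi t) of the
    unnormalised Gaussian it is the Gamma weight again.\<close>
  have hs: "h t * sqrt (pi / (1 / (4 * t))) = gauss_weight \<alpha> t" if "t > 0" for t
    using that by (simp add: h_def real_sqrt_divide real_sqrt_mult)
  have hnn: "h t \<ge> 0" for t
    using a gauss_weight_nonneg[of \<alpha> t] h0[of t] by (cases "t > 0") (auto simp: h_def)
  have inner: "integrable lborel (F t)" for t
  proof (cases "t > 0")
    case True
    then have t: "1 / (4 * t) > 0" by simp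
    have "integrable lborel (\<lambda>y. of_real (exp (- (1 / (4 * t)) * y\<^sup>2)) * exp (\<i> * of_real (w * y)) :: complex)"
      by (rule Bochner_Integration.integrable_bound[OF gaussian_integrable[OF t]]) (auto simp: norm_mult)
    then show ?thesis unfolding F_def by (rule integrable_mult_right)
  qed (simp add: F_def h0)
  have int: "integrable (lborel \<Otimes>\<^sub>M lborel) (case_prod F)"
  proof (rule lborel_pair.Fubini_integrable)
    show "case_prod F \<in> borel_measurable (lborel \<Otimes>\<^sub>M lborel)" unfolding F_def by measurable
    have "(\<integral>y. norm (F t y) \<partial>lborel) = gauss_weight \<alpha> t" for t
    proof (cases "t > 0")
      case True
      then have t: "1 / (4 * t) > 0" by simp
      have "(\<integral>y. norm (F t y) \<partial>lborel) = h t * (\<integral>y. exp (- (1 / (4 * t)) * y\<^sup>2) \<partial>lborel)"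
        using hnn[of t] by (simp add: F_def norm_mult)
      then show ?thesis by (simp only: gaussian_integral[OF t] hs[OF True])
    qed (simp add: F_def h0 gauss_weight_def)
    then show "integrable lborel (\<lambda>t. \<integral>y. norm (case_prod F (t, y)) \<partial>lborel)"
      using gauss_weight_integrable[of \<alpha>] a by simp
    show "AE t in lborel. integrable lborel (\<lambda>y. case_prod F (t, y))"
      using inner by simp
  qed
  have k: "(\<integral>t. F t y \<partial>lborel) = of_real (kern_real \<alpha> y) * exp (\<i> * of_real (w * y))" for y
  proof -
    have "(\<integral>t. F t y \<partial>lborel) = (\<integral>t. of_real (gauss_weight \<alpha> t * (sqrt (pi / t) * exp (- y\<^sup>2 / (4 * t)) / (2 * pi))) * exp (\<i> * of_real (w * y)) \<partial>lborel)"
      by (simp add: F_def h_def mult.assoc)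
    then show ?thesis by (simp add: kern_real_def del: of_real_mult of_real_divide)
  qed
  show ?I using lborel_pair.integrable_snd[OF int] by (simp add: k)
  have 1: "(\<integral>y. (\<integral>t. F t y \<partial>lborel) \<partial>lborel) = (\<integral>t. (\<integral>y. F t y \<partial>lborel) \<partial>lborel)"
    by (rule lborel_pair.Fubini_integral[OF int])
  have 2: "(\<integral>y. F t y \<partial>lborel) = of_real (gauss_weight \<alpha> t * exp (- t * w\<^sup>2))" for t
  proof (cases "t > 0")
    case True
    then have t: "1 / (4 * t) > 0" by simp
    have "(\<integral>y. F t y \<partial>lborel) = of_real (h t * sqrt (pi / (1 / (4 * t))) * exp (- w\<^sup>2 / (4 * (1 / (4 * t)))))"
      unfolding F_def integral_mult_right_zero gaussian_fourier[OF t] by simp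
    then show ?thesis by (simp only: hs[OF True]) (simp add: mult.commute)
  qed (simp add: F_def h0 gauss_weight_def)
  show ?E
    using has_bochner_integral_gauss_weight[of \<alpha> w] a 1
    by (simp add: k 2 has_bochner_integral_iff del: of_real_mult)
qed

lemma kern_real_integrable: "\<alpha> > 1 \<Longrightarrow> integrable lborel (kern_real \<alpha>)"
  using kern_real_fourier(1)[of \<alpha> 0] by (simp add: complex_of_real_integrable_eq)

lemma kern_real_shift_integrable: "\<alpha> > 1 \<Longrightarrow> integrable lborel (\<lambda>y. kern_real \<alpha> (x - y))"
  using lborel_integrable_real_affine[OF kern_real_integrable, of \<alpha> "-1" x] by simp

text \<open>After z = x - y the addition formula splits the integral into real and imaginary part of
  the Fourier transform, and the latter vanishes because the symbol is real. Cosines are thus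
  eigenfunctions of the operator.\<close>

lemma kern_real_cos:
  assumes a: "\<alpha> > 1"
  shows "(LINT y|lborel. kern_real \<alpha> (x - y) * cos (w * y)) = symb \<alpha> w * cos (w * x)"
proof -
  have I: "integrable lborel (\<lambda>z. kern_real \<alpha> z * cos (w * z))"
     "integrable lborel (\<lambda>z. kern_real \<alpha> z * sin (w * z))"
    by (rule Bochner_Integration.integrable_bound[OF kern_real_integrable[OF a]];
        use borel_measurable_integrable[OF kern_real_integrable[OF a]] in \<open>auto simp: abs_mult mult_left_le\<close>)+
  have E: "(LINT z|lborel. kern_real \<alpha> z * cos (w * z)) = symb \<alpha> w"
     "(LINT z|lborel. kern_real \<alpha> z * sin (w * z)) = 0"
    using kern_real_fourier(2)[OF a, of w, THEN arg_cong[of _ _ Re]]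
      kern_real_fourier(2)[OF a, of w, THEN arg_cong[of _ _ Im]]
    unfolding integral_Re[OF kern_real_fourier(1)[OF a], symmetric]
      integral_Im[OF kern_real_fourier(1)[OF a], symmetric]
    by (simp_all add: Re_exp Im_exp)
  have "(LINT y|lborel. kern_real \<alpha> (x - y) * cos (w * y))
     = \<bar>-1\<bar> *\<^sub>R (LINT z|lborel. kern_real \<alpha> (x - (x + -1 * z)) * cos (w * (x + -1 * z)))"
    by (rule lborel_integral_real_affine) simp
  also have "\<dots> = (LINT z|lborel. cos (w * x) * (kern_real \<alpha> z * cos (w * z)) +
       sin (w * x) * (kern_real \<alpha> z * sin (w * z)))"
    by (simp add: right_diff_distrib cos_diff algebra_simps)
  also have "\<dots> = symb \<alpha> w * cos (w * x)"
    using I by (simp add: E)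
  finally show ?thesis .
qed

section \<open>The convolution operator on bounded real functions\<close>

definition L_real :: "real \<Rightarrow> (real \<Rightarrow> real) \<Rightarrow> real \<Rightarrow> real" where
  "L_real \<alpha> f x = (LINT y|lborel. kern_real \<alpha> (x - y) * f y)"

lemma L_of_real: "\<alpha> > 1 \<Longrightarrow> L \<alpha> (\<lambda>y. of_real (f y)) x = of_real (L_real \<alpha> f x)"
  by (simp add: L_def Defs.convolution_def kern_eq L_real_def flip: of_real_mult)

lemma L_real_integrable:
  assumes a: "\<alpha> > 1" and f: "f \<in> borel_measurable borel" "bounded (range f)"
  shows "integrable lborel (\<lambda>y. kern_real \<alpha> (x - y) * f y)"
proof -
  obtain B where B: "\<And>y. \<bar>f y\<bar> \<le> B" using f(2) by (auto simp: bounded_iff)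
  show ?thesis
  proof (rule Bochner_Integration.integrable_bound)
    show "integrable lborel (\<lambda>y. B * kern_real \<alpha> (x - y))"
      by (intro integrable_mult_right kern_real_shift_integrable a)
    show "(\<lambda>y. kern_real \<alpha> (x - y) * f y) \<in> borel_measurable lborel"
      using f(1) borel_measurable_integrable[OF kern_real_shift_integrable[OF a, of x]] by simp
    have "\<bar>kern_real \<alpha> (x - y)\<bar> * \<bar>f y\<bar> \<le> \<bar>kern_real \<alpha> (x - y)\<bar> * \<bar>B\<bar>" for y
      using B[of y] by (intro mult_left_mono) auto
    then show "AE y in lborel. norm (kern_real \<alpha> (x - y) * f y) \<le> norm (B * kern_real \<alpha> (x - y))"
      by (simp add: abs_mult mult.commute)
  qed
qed

lemma L_real_lin:
  assumes "\<alpha> > 1" "f \<in> borel_measurable borel" "bounded (range f)"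
    "g \<in> borel_measurable borel" "bounded (range g)"
  shows "L_real \<alpha> (\<lambda>y. a * f y + b * g y) x = a * L_real \<alpha> f x + b * L_real \<alpha> g x"
proof -
  have "L_real \<alpha> (\<lambda>y. a * f y + b * g y) x = (LINT y|lborel. a * (kern_real \<alpha> (x - y) * f y) + b * (kern_real \<alpha> (x - y) * g y))"
    by (simp add: L_real_def algebra_simps)
  then show ?thesis using L_real_integrable[OF assms(1-3), of x] L_real_integrable[OF assms(1,4,5), of x]
    by (simp add: L_real_def)
qed

lemma L_real_uniform_limit:
  assumes a: "\<alpha> > 1" and f: "\<And>n. f n \<in> borel_measurable borel" "\<And>n. bounded (range (f n))"
    and g: "g \<in> borel_measurable borel" "bounded (range g)"
    and lim: "uniform_limit UNIV f g sequentially"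
  shows "(\<lambda>n. L_real \<alpha> (f n) x) \<longlonglongrightarrow> L_real \<alpha> g x"
proof -
  obtain B where B: "\<And>y. \<bar>g y\<bar> \<le> B" using g(2) by (auto simp: bounded_iff)
  have "\<forall>\<^sub>F n in sequentially. \<forall>y. \<bar>f n y - g y\<bar> < 1"
    using uniform_limitD[OF lim, of 1] by (simp add: dist_real_def)
  then have "\<forall>\<^sub>F n in sequentially. \<forall>y. \<bar>f n y\<bar> \<le> B + 1"
  proof eventually_elim
    case (elim n)
    show ?case
    proof
      fix y show "\<bar>f n y\<bar> \<le> B + 1" using elim[rule_format, of y] B[of y] by linarith
    qed
  qed
  \<comment> \<open>Early members of the sequence need not obey the bound \<open>B + 1\<close>, so
    dominated convergence is run on the tail and the shift is removed at the end.\<close>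
  then obtain N where N: "\<And>n y. \<bar>f (n + N) y\<bar> \<le> B + 1"
    by (auto simp: eventually_sequentially) (metis le_add2)
  have pt: "(\<lambda>n. f n y) \<longlonglongrightarrow> g y" for y
    using tendsto_uniform_limitI[OF lim] by simp
  have km: "(\<lambda>y. kern_real \<alpha> (x - y)) \<in> borel_measurable lborel"
    using kern_real_shift_integrable[OF a] by (rule borel_measurable_integrable)
  have "(\<lambda>n. LINT y|lborel. kern_real \<alpha> (x - y) * f (n + N) y) \<longlonglongrightarrow> (LINT y|lborel. kern_real \<alpha> (x - y) * g y)"
  proof (rule integral_dominated_convergence)
    show "integrable lborel (\<lambda>y. \<bar>kern_real \<alpha> (x - y)\<bar> * (B + 1))"
      by (intro integrable_mult_left integrable_abs kern_real_shift_integrable a)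
    show "AE y in lborel. (\<lambda>n. kern_real \<alpha> (x - y) * f (n + N) y) \<longlonglongrightarrow> kern_real \<alpha> (x - y) * g y"
      by (intro AE_I2 tendsto_intros LIMSEQ_ignore_initial_segment pt)
    show "AE y in lborel. norm (kern_real \<alpha> (x - y) * f (n + N) y) \<le> \<bar>kern_real \<alpha> (x - y)\<bar> * (B + 1)" for n
      using N by (auto simp: abs_mult intro!: mult_left_mono)
  qed (use km f g in simp_all)
  from LIMSEQ_offset[OF this[folded L_real_def]] show ?thesis .
qed

section \<open>The Neumann resolvent on an interval\<close>

text \<open>Since f' vanishes at x and has positive slope there, it is positive just to the right,
  and the mean value theorem makes f grow. Derivatives are taken within [a,b], so x may be the left
  endpoint.\<close>

lemma increasing_right_of_zero_deriv:
  fixes f f' :: "real \<Rightarrow> real"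
  assumes f: "\<And>y. y \<in> {a..b} \<Longrightarrow> (f has_real_derivative f' y) (at y within {a..b})"
    and f': "(f' has_real_derivative c) (at x within {a..b})"
    and "f' x = 0" "c > 0" "a \<le> x" "x < b"
  obtains y where "y \<in> {a..b}" "f x < f y"
proof -
  obtain d where d: "d > 0" "\<And>h. h > 0 \<Longrightarrow> x + h \<in> {a..b} \<Longrightarrow> h < d \<Longrightarrow> f' x < f' (x + h)"
    using has_real_derivative_pos_inc_right[OF f' \<open>c > 0\<close>] by blast
  define y where "y = x + min (d/2) (b - x)"
  have y: "x < y" "y \<le> b" "y < x + d" using \<open>x < b\<close> d(1) by (auto simp: y_def)
  have "\<exists>z\<in>{x<..<y}. f y - f x = (*) (f' z) (y - x)"
  proof (rule mvt_simple[OF y(1)])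
    fix z assume "x \<le> z" "z \<le> y"
    then have "z \<in> {a..b}" "{x..y} \<subseteq> {a..b}" using \<open>a \<le> x\<close> y by auto
    then show "(f has_derivative (*) (f' z)) (at z within {x..y})"
      using DERIV_subset[OF f] by (simp add: has_field_derivative_def)
  qed
  then obtain z where z: "x < z" "z < y" "f y - f x = f' z * (y - x)" by auto
  have "f' z > 0" using d(2)[of "z - x"] z y \<open>a \<le> x\<close> \<open>f' x = 0\<close> by auto
  then have "f' z * (y - x) > 0" using y by simp
  then have "f x < f y" using z by simp
  then show thesis using that[of y] y \<open>a \<le> x\<close> by auto
qed

text \<open>A positive second derivative would make f exceed its maximum nearby. That f' vanishes is
  assumed rather than derived because x may be an endpoint, where the Neumann condition supplies
  it.\<close>

lemma max_second_deriv_nonpos: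
  fixes f f' :: "real \<Rightarrow> real"
  assumes "a < b"
    and f: "\<And>y. y \<in> {a..b} \<Longrightarrow> (f has_real_derivative f' y) (at y within {a..b})"
    and f': "(f' has_real_derivative c) (at x within {a..b})"
    and "f' x = 0" and x: "x \<in> {a..b}" and max: "\<And>y. y \<in> {a..b} \<Longrightarrow> f y \<le> f x"
  shows "c \<le> 0"
proof (rule ccontr)
  assume "\<not> c \<le> 0"
  then have c: "c > 0" by simp
  show False
  proof (cases "x < b")
    case True
    from x have "a \<le> x" by simp
    from increasing_right_of_zero_deriv[OF f f' \<open>f' x = 0\<close> c this True]
    obtain y where "y \<in> {a..b}" "f x < f y" by metis
    then show False using max[of y] by simp
  next
    \<comment> \<open>Nothing lies to the right of b, so the interval is reflected by y -> -y; this
      flips the sign of f' and keeps that of the second derivative.\<close>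
    case False
    then have xb: "x = b" using x by auto
    have refl: "uminus ` {- b.. - a} = {a..b}" by (simp add: )
    have m: "(uminus has_real_derivative - 1) (at y within {-b..-a})" for y :: real
      by (auto intro!: derivative_eq_intros)
    have g: "((\<lambda>y. f (- y)) has_real_derivative - f' (- y)) (at y within {-b..-a})"
      if "y \<in> {-b..-a}" for y
      using DERIV_image_chain[of f "f' (-y)" uminus y "{-b..-a}" "-1", unfolded refl, OF f m] that
      by (simp add: o_def)
    have g': "((\<lambda>y. - f' (- y)) has_real_derivative c) (at (-b) within {-b..-a})"
      using DERIV_minus[OF DERIV_image_chain[of f' c uminus "-b" "{-b..-a}" "-1", unfolded refl, OF _ m]] f'
      by (simp add: o_def xb)
    have "- f' (- (- b)) = 0" "- b \<le> - b" "- b < - a"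
      using \<open>f' x = 0\<close> xb \<open>a < b\<close> by auto
    from increasing_right_of_zero_deriv[OF g g' this(1) c this(2,3)]
    obtain y where "y \<in> {-b..-a}" "f (- (- b)) < f (- y)" by metis
    then show False using max[of "-y"] xb by auto
  qed
qed

lemma interior_max_deriv_zero:
  fixes f :: "real \<Rightarrow> real"
  assumes "(f has_real_derivative l) (at x within {a..b})" "a < x" "x < b"
    and max: "\<And>y. y \<in> {a..b} \<Longrightarrow> f y \<le> f x"
  shows "l = 0"
proof (rule DERIV_local_max)
  show "(f has_real_derivative l) (at x)"
    using assms by (simp add: at_within_Icc_at)
  show "0 < min (x - a) (b - x)" using assms by simp
  show "\<forall>y. \<bar>x - y\<bar> < min (x - a) (b - x) \<longrightarrow> f y \<le> f x"
    by (auto intro!: max simp: abs_if split: if_splits)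
qed

text \<open>The boundary value problem c u - u'' = g on [0,pi] with u' = 0 at both ends, as a
  first-order system with v = u'. An explicit v lets the maximum principle be applied to u' as
  well.\<close>

definition neumann :: "real \<Rightarrow> (real \<Rightarrow> real) \<Rightarrow> (real \<Rightarrow> real) \<Rightarrow> (real \<Rightarrow> real) \<Rightarrow> bool" where
  "neumann c g u v \<longleftrightarrow> (\<forall>x\<in>{0..pi}. (u has_real_derivative v x) (at x within {0..pi}) \<and>
      (v has_real_derivative c * u x - g x) (at x within {0..pi})) \<and> v 0 = 0 \<and> v pi = 0"

text \<open>Maximum principle: where u is largest, v vanishes (by the boundary condition if the
  point is an endpoint) and u'' \<le> 0, so c u \<le> g \<le> B there.\<close>

lemma neumann_le:
  assumes n: "neumann c g u v" and c: "c > 0" and g: "\<And>x. x \<in> {0..pi} \<Longrightarrow> g x \<le> B"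
    and y: "y \<in> {0..pi}"
  shows "u y \<le> B / c"
proof -
  have u: "(u has_real_derivative v x) (at x within {0..pi})"
    and v: "(v has_real_derivative c * u x - g x) (at x within {0..pi})" if "x \<in> {0..pi}" for x
    using n that by (auto simp: neumann_def)
  have "continuous_on {0..pi} u" by (rule DERIV_continuous_on[OF u])
  then obtain x where x: "x \<in> {0..pi}" and max: "\<And>y. y \<in> {0..pi} \<Longrightarrow> u y \<le> u x"
    using continuous_attains_sup[of "{0..pi}" u] by auto
  have "v x = 0"
  proof (cases "x = 0 \<or> x = pi")
    case True then show ?thesis using n by (auto simp: neumann_def)
  next
    case False then show ?thesis using interior_max_deriv_zero[OF u[OF x] _ _ max] x by auto
  qed
  then have "c * u x - g x \<le> 0"
    by (intro max_second_deriv_nonpos[OF pi_gt_zero u v[OF x] _ x max])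
  then have "u x \<le> B / c" using g[OF x] c by (simp add: pos_le_divide_eq mult.commute)
  then show ?thesis using max[OF y] by simp
qed

lemma neumann_lin:
  assumes "neumann c g1 u1 v1" "neumann c g2 u2 v2"
  shows "neumann c (\<lambda>x. a * g1 x + b * g2 x) (\<lambda>x. a * u1 x + b * u2 x) (\<lambda>x. a * v1 x + b * v2 x)"
  unfolding neumann_def
proof (intro conjI ballI)
  fix x :: real assume x: "x \<in> {0..pi}"
  note d = assms[unfolded neumann_def, THEN conjunct1, rule_format, OF x]
  show "((\<lambda>x. a * u1 x + b * u2 x) has_real_derivative a * v1 x + b * v2 x) (at x within {0..pi})"
    by (intro DERIV_add DERIV_cmult d[THEN conjunct1])
  have "((\<lambda>x. a * v1 x + b * v2 x) has_real_derivative a * (c * u1 x - g1 x) + b * (c * u2 x - g2 x))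
      (at x within {0..pi})"
    by (intro DERIV_add DERIV_cmult d[THEN conjunct2])
  then show "((\<lambda>x. a * v1 x + b * v2 x) has_real_derivative
      c * (a * u1 x + b * u2 x) - (a * g1 x + b * g2 x)) (at x within {0..pi})"
    by (simp add: algebra_simps)
qed (use assms in \<open>simp_all add: neumann_def\<close>)

lemma neumann_abs_le:
  assumes n: "neumann c g u v" and c: "c > 0" and g: "\<And>x. x \<in> {0..pi} \<Longrightarrow> \<bar>g x\<bar> \<le> B"
    and y: "y \<in> {0..pi}"
  shows "\<bar>u y\<bar> \<le> B / c"
proof -
  have "u y \<le> B / c" using g by (intro neumann_le[OF n c _ y]) (simp add: abs_le_iff)
  \<comment> \<open>The coefficients -1 and 0 in \<open>neumann_lin\<close> produce the problem
    solved by -u.\<close>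
  moreover have "- u y \<le> B / c"
    using g neumann_le[OF neumann_lin[OF n n, of "-1" 0] c _ y, of B] by (simp add: abs_le_iff)
  ultimately show ?thesis by simp
qed

text \<open>The difference solves the problem with zero data, and the sup bound forces it to
  vanish.\<close>

lemma neumann_unique:
  assumes "neumann c g1 u1 v1" "neumann c g2 u2 v2" "c > 0"
    and "\<And>x. x \<in> {0..pi} \<Longrightarrow> g1 x = g2 x" "y \<in> {0..pi}"
  shows "u1 y = u2 y"
  using neumann_abs_le[OF neumann_lin[OF assms(1,2), of 1 "-1"] \<open>c > 0\<close>, of 0 y] assms(4,5) by simp

text \<open>Variation of constants: the coefficient of \<open>cosh (a x)\<close> is the one that makes the derivative
  vanish at \<open>\<pi>\<close>.\<close>

definition neumann_resolvent :: "real \<Rightarrow> (real \<Rightarrow> real) \<Rightarrow> real \<Rightarrow> real" where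
  "neumann_resolvent c g x = (let a = sqrt c in
     integral {0..pi} (\<lambda>y. cosh (a * (pi - y)) * g y) / (a * sinh (a * pi)) * cosh (a * x)
     - (sinh (a * x) * integral {0..x} (\<lambda>y. cosh (a * y) * g y)
        - cosh (a * x) * integral {0..x} (\<lambda>y. sinh (a * y) * g y)) / a)"

lemma neumann_resolvent_solves:
  assumes c: "c > 0" and g: "continuous_on {0..pi} g"
  obtains v where "neumann c g (neumann_resolvent c g) v"
proof -
  define a where "a = sqrt c"
  have a: "a > 0" "a * a = c" using c by (auto simp: a_def)
  define A where "A = integral {0..pi} (\<lambda>y. cosh (a * (pi - y)) * g y) / (a * sinh (a * pi))"
  define C where "C = (\<lambda>x. integral {0..x} (\<lambda>y. cosh (a * y) * g y))"
  define S where "S = (\<lambda>x. integral {0..x} (\<lambda>y. sinh (a * y) * g y))"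
  have eq: "neumann_resolvent c g = (\<lambda>x. A * cosh (a * x) - (sinh (a * x) * C x - cosh (a * x) * S x) / a)"
    by (auto simp: neumann_resolvent_def Let_def A_def C_def S_def a_def)
  define v where "v = (\<lambda>x. a * A * sinh (a * x) - (cosh (a * x) * C x - sinh (a * x) * S x))"
  have dC: "(C has_real_derivative cosh (a * x) * g x) (at x within {0..pi})"
    and dS: "(S has_real_derivative sinh (a * x) * g x) (at x within {0..pi})" if "x \<in> {0..pi}" for x
    unfolding C_def S_def using that g
    by (intro integral_has_real_derivative continuous_intros; simp)+
  \<comment> \<open>The product rule leaves - (cosh^2 - sinh^2) g in v'; this identity reduces it to
    the source term -g.\<close>
  have cs: "cosh z * (cosh z * w) = w + sinh z * (sinh z * w)" for z w :: real
    using cosh_square_eq[of z] by (simp add: power2_eq_square algebra_simps)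
  have 1: "(neumann_resolvent c g has_real_derivative v x) (at x within {0..pi})" if "x \<in> {0..pi}" for x
    unfolding eq v_def using a
    by (auto intro!: derivative_eq_intros dC dS that simp: field_simps)
  have 2: "(v has_real_derivative c * neumann_resolvent c g x - g x) (at x within {0..pi})" if "x \<in> {0..pi}" for x
    unfolding eq v_def using a cs[of "a * x" "g x"]
    by (auto intro!: derivative_eq_intros dC dS that simp: field_simps)
  have sp: "sinh (a * pi) > 0" using a by simp
  \<comment> \<open>By the addition formula the numerator of \<open>A\<close> is exactly the
    integral part of \<open>v\<close> at pi, so the two cancel there.\<close>
  have "integral {0..pi} (\<lambda>y. cosh (a * (pi - y)) * g y)
      = integral {0..pi} (\<lambda>y. cosh (a * pi) * (cosh (a * y) * g y) - sinh (a * pi) * (sinh (a * y) * g y))"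
    by (intro arg_cong[of _ _ "integral {0..pi}"] ext)
       (simp add: cosh_diff right_diff_distrib left_diff_distrib mult.assoc)
  also have "\<dots> = cosh (a * pi) * C pi - sinh (a * pi) * S pi"
    unfolding C_def S_def
    by (subst integral_diff)
       (auto intro!: integrable_continuous_interval continuous_intros g)
  finally have "A * (a * sinh (a * pi)) = cosh (a * pi) * C pi - sinh (a * pi) * S pi"
    using a sp by (simp add: A_def)
  then have "v pi = 0" by (simp add: v_def algebra_simps)
  moreover have "v 0 = 0" by (simp add: v_def C_def)
  ultimately have "neumann c g (neumann_resolvent c g) v" using 1 2 by (auto simp: neumann_def)
  then show thesis by (rule that)
qed

lemma neumann_resolvent_continuous:
  assumes "c > 0" "continuous_on {0..pi} g"
  shows "continuous_on {0..pi} (neumann_resolvent c g)"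
proof -
  obtain v where "neumann c g (neumann_resolvent c g) v" by (rule neumann_resolvent_solves[OF assms])
  then show ?thesis by (intro DERIV_continuous_on[of _ _ v]) (auto simp: neumann_def)
qed

lemma neumann_resolvent_abs_le:
  assumes "c > 0" "continuous_on {0..pi} g" "\<And>x. x \<in> {0..pi} \<Longrightarrow> \<bar>g x\<bar> \<le> B" "y \<in> {0..pi}"
  shows "\<bar>neumann_resolvent c g y\<bar> \<le> B / c"
proof -
  obtain v where "neumann c g (neumann_resolvent c g) v" by (rule neumann_resolvent_solves[OF assms(1,2)])
  then show ?thesis by (rule neumann_abs_le[OF _ assms(1,3,4)])
qed

lemma neumann_resolvent_lin:
  assumes "c > 0" "continuous_on {0..pi} g" "continuous_on {0..pi} h" "y \<in> {0..pi}"
  shows "neumann_resolvent c (\<lambda>x. a * g x + b * h x) y = a * neumann_resolvent c g y + b * neumann_resolvent c h y"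
proof -
  obtain v w where "neumann c g (neumann_resolvent c g) v" "neumann c h (neumann_resolvent c h) w"
    using neumann_resolvent_solves assms by meson
  note 1 = neumann_lin[OF this, of a b]
  have "continuous_on {0..pi} (\<lambda>x. a * g x + b * h x)"
    by (intro continuous_intros assms)
  then obtain z where "neumann c (\<lambda>x. a * g x + b * h x) (neumann_resolvent c (\<lambda>x. a * g x + b * h x)) z"
    using neumann_resolvent_solves assms by meson
  from neumann_unique[OF this 1] show ?thesis using assms by simp
qed

text \<open>For integer n the derivative of cos (n x) vanishes at 0 and pi, so cos (n x) / (c + n^2)
  solves the Neumann problem, and uniqueness identifies it with the resolvent.\<close>

lemma neumann_resolvent_cos:
  assumes "c > 0" "y \<in> {0..pi}"
  shows "neumann_resolvent c (\<lambda>x. cos (of_int n * x)) y = cos (of_int n * y) / (c + (of_int n)\<^sup>2)"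
proof -
  define r where "r = real_of_int n"
  define D where "D = c + r\<^sup>2"
  have D: "D > 0" using assms by (simp add: D_def add_pos_nonneg)
  have "D \<noteq> 0" using D by simp
  have "sin (r * pi) = 0" unfolding r_def by (simp add: sin_zero_iff_int2)
  moreover have "((\<lambda>x. - r * sin (r * x) / D) has_real_derivative c * (cos (r * x) / D) - cos (r * x))
      (at x within {0..pi})" for x
  proof -
    have "((\<lambda>x. - r * sin (r * x) / D) has_real_derivative - r * (cos (r * x) * r) / D) (at x within {0..pi})"
      using \<open>D \<noteq> 0\<close> by (auto intro!: derivative_eq_intros)
    moreover have "- r * (cos (r * x) * r) / D = c * (cos (r * x) / D) - cos (r * x)"
    proof -
      have "c * (cos (r * x) / D) - cos (r * x) = (c - D) * cos (r * x) / D"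
        using \<open>D \<noteq> 0\<close> by (simp add: left_diff_distrib diff_divide_distrib)
      then show ?thesis by (simp add: D_def power2_eq_square mult_ac)
    qed
    ultimately show ?thesis by simp
  qed
  moreover have "((\<lambda>x. cos (r * x) / D) has_real_derivative - r * sin (r * x) / D) (at x within {0..pi})" for x
    using \<open>D \<noteq> 0\<close> by (auto intro!: derivative_eq_intros)
  ultimately have 1: "neumann c (\<lambda>x. cos (r * x)) (\<lambda>x. cos (r * x) / D) (\<lambda>x. - r * sin (r * x) / D)"
    unfolding neumann_def by simp
  obtain v where "neumann c (\<lambda>x. cos (r * x)) (neumann_resolvent c (\<lambda>x. cos (r * x))) v"
    by (rule neumann_resolvent_solves[OF assms(1), of "\<lambda>x. cos (r * x)"]) (intro continuous_intros)
  from neumann_unique[OF this 1] show ?thesis using assms by (simp add: r_def D_def)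
qed

text \<open>In the inductions over powers, a power is known only on [0,pi], so the next resolvent
  must be insensitive to values elsewhere.\<close>

lemma neumann_resolvent_cong:
  assumes "c > 0" "continuous_on {0..pi} g" "\<And>x. x \<in> {0..pi} \<Longrightarrow> g x = h x" "y \<in> {0..pi}"
  shows "neumann_resolvent c g y = neumann_resolvent c h y"
proof -
  have h: "continuous_on {0..pi} h"
    using assms(2) by (rule continuous_on_eq) (rule assms(3))
  obtain v where v: "neumann c g (neumann_resolvent c g) v" by (rule neumann_resolvent_solves[OF assms(1,2)])
  obtain w where w: "neumann c h (neumann_resolvent c h) w" by (rule neumann_resolvent_solves[OF assms(1) h])
  show ?thesis by (rule neumann_unique[OF v w assms(1,3,4)])
qed

text \<open>At 0 the integrals over {0..x} vanish, and what remains is an integral of g against a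
  strictly positive cosh weight. This takes the place of a strong maximum principle.\<close>

lemma neumann_resolvent_zero_pos:
  assumes c: "c > 0" and g: "continuous_on {0..pi} g" "\<And>x. x \<in> {0..pi} \<Longrightarrow> 0 \<le> g x"
    and z: "z \<in> {0..pi}" "g z \<noteq> 0"
  shows "neumann_resolvent c g 0 > 0"
proof -
  define a where "a = sqrt c"
  have a: "a > 0" using c by (simp add: a_def)
  define I where "I = integral {0..pi} (\<lambda>y. cosh (a * (pi - y)) * g y)"
  have "I \<ge> 0" unfolding I_def using g(2)
    by (intro integral_nonneg integrable_continuous_interval continuous_intros g(1)) auto
  moreover have "I \<noteq> 0"
  proof
    assume "I = 0"
    moreover have "continuous_on {0..pi} (\<lambda>y. cosh (a * (pi - y)) * g y)"
      by (intro continuous_intros g(1))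
    ultimately have "\<forall>y\<in>{0..pi}. cosh (a * (pi - y)) * g y = 0"
      unfolding I_def using integral_eq_0_iff[of 0 pi "\<lambda>y. cosh (a * (pi - y)) * g y"] g(2) by simp
    then show False using z by force
  qed
  ultimately have "I > 0" by simp
  moreover have "neumann_resolvent c g 0 = I / (a * sinh (a * pi))"
    by (simp add: neumann_resolvent_def Let_def I_def a_def)
  ultimately show ?thesis using a by simp
qed

text \<open>Here u'(0) = 0 and u''(0) = c u(0) - g(0) < 0, so u falls at least quadratically to the
  right of 0.\<close>

lemma neumann_quadratic_drop:
  assumes n: "neumann c g u v" and neg: "c * u 0 < g 0"
  obtains e d where "e > 0" "d > 0" "\<And>x. 0 < x \<Longrightarrow> x < d \<Longrightarrow> e * x\<^sup>2 \<le> u 0 - u x"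
proof -
  \<comment> \<open>With this e, u''(0) = -4 e, so v + 2 e x still has the negative slope -2 e at 0
    and u + e x^2 decreases just to the right.\<close>
  define e where "e = (g 0 - c * u 0) / 4"
  have e: "e > 0" using neg by (simp add: e_def)
  have u: "(u has_real_derivative v x) (at x within {0..pi})"
    and v: "(v has_real_derivative c * u x - g x) (at x within {0..pi})" if "x \<in> {0..pi}" for x
    using n that by (auto simp: neumann_def)
  have "((\<lambda>x. v x + 2 * e * x) has_real_derivative (c * u 0 - g 0) + 2 * e) (at 0 within {0..pi})"
    by (auto intro!: derivative_eq_intros v)
  moreover have "(c * u 0 - g 0) + 2 * e < 0" using neg by (simp add: e_def field_simps)
  ultimately have "\<exists>d>0. \<forall>h>0. 0 + h \<in> {0..pi} \<longrightarrow> h < d \<longrightarrow>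
      v 0 + 2 * e * 0 > v (0 + h) + 2 * e * (0 + h)"
    by (rule has_real_derivative_neg_dec_right)
  then obtain d where d: "d > 0"
     "\<And>h. h > 0 \<Longrightarrow> h \<in> {0..pi} \<Longrightarrow> h < d \<Longrightarrow> v h + 2 * e * h < v 0"
    by auto
  have v0: "v 0 = 0" using n by (simp add: neumann_def)
  have "e * x\<^sup>2 \<le> u 0 - u x" if x: "0 < x" "x < min d pi" for x
  proof -
    have "\<exists>z\<in>{0<..<x}. (u x + e * x\<^sup>2) - (u 0 + e * 0\<^sup>2) = (*) (v z + 2 * e * z) (x - 0)"
    proof (rule mvt_simple[OF x(1)])
      fix z assume "0 \<le> z" "z \<le> x"
      then have z: "z \<in> {0..pi}" "{0..x} \<subseteq> {0..pi}" using x by auto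
      have "((\<lambda>x. u x + e * x\<^sup>2) has_real_derivative v z + 2 * e * z) (at z within {0..pi})"
        by (auto intro!: derivative_eq_intros u z)
      from DERIV_subset[OF this z(2)]
      show "((\<lambda>x. u x + e * x\<^sup>2) has_derivative (*) (v z + 2 * e * z)) (at z within {0..x})"
        by (simp add: has_field_derivative_def)
    qed
    then obtain z where z: "0 < z" "z < x" "u x + e * x\<^sup>2 - u 0 = (v z + 2 * e * z) * x" by auto
    have "v z + 2 * e * z < 0" using d(2)[of z] z x v0 by auto
    then have "(v z + 2 * e * z) * x \<le> 0" using x by (simp add: mult_nonpos_nonneg)
    then show ?thesis using z by simp
  qed
  then show thesis using that[of e "min d pi"] e d(1) by auto
qed

text \<open>The class that the resolvent preserves. It is phrased with a derivative because the
  maximum principle will be applied to u', whose equation has g' as source; nonconstancy makes the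
  drop at 0 strict.\<close>

definition nonconst_decreasing :: "(real \<Rightarrow> real) \<Rightarrow> bool" where
  "nonconst_decreasing g \<longleftrightarrow> (\<exists>g'. \<forall>x\<in>{0..pi}. (g has_real_derivative g' x) (at x within {0..pi}) \<and> g' x \<le> 0)
     \<and> (\<exists>z\<in>{0..pi}. g z \<noteq> g 0)"

lemma nonconst_decreasing_continuous: "nonconst_decreasing g \<Longrightarrow> continuous_on {0..pi} g"
  unfolding nonconst_decreasing_def by (meson DERIV_continuous_on)

lemma nonconst_decreasing_le:
  assumes "nonconst_decreasing g" "0 \<le> x" "x \<le> y" "y \<le> pi"
  shows "g y \<le> g x"
proof (cases "x = y")
  case False
  obtain g' where g': "\<And>x. x\<in>{0..pi} \<Longrightarrow> (g has_real_derivative g' x) (at x within {0..pi}) \<and> g' x \<le> 0"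
    using assms(1) unfolding nonconst_decreasing_def by blast
  have "\<exists>z\<in>{x<..<y}. g y - g x = (*) (g' z) (y - x)"
  proof (rule mvt_simple)
    show "x < y" using assms False by simp
    fix z assume "x \<le> z" "z \<le> y"
    then have "z \<in> {0..pi}" "{x..y} \<subseteq> {0..pi}" using assms by auto
    then show "(g has_derivative (*) (g' z)) (at z within {x..y})"
      using DERIV_subset[of g "g' z" z "{0..pi}"] g' by (simp add: has_field_derivative_def)
  qed
  then obtain z where "x < z" "z < y" "g y - g x = g' z * (y - x)" by auto
  moreover have "g' z \<le> 0" using g'[of z] calculation assms by auto
  moreover have "g' z * (y - x) \<le> 0" using calculation by (simp add: mult_nonpos_nonneg)
  ultimately show ?thesis by simp
qed simp

text \<open>The resolvent of the constant g(0) is g(0)/c, while g(0) - g is nonnegative and not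
  identically zero, so its resolvent is positive at 0. Hence c u(0) < g(0), as the quadratic drop
  requires.\<close>

lemma neumann_resolvent_drop:
  assumes c: "c > 0" and g: "nonconst_decreasing g"
  obtains e d where "e > 0" "d > 0" "\<And>x. 0 < x \<Longrightarrow> x < d \<Longrightarrow> e * x\<^sup>2 \<le> neumann_resolvent c g 0 - neumann_resolvent c g x"
proof -
  have cg: "continuous_on {0..pi} g" using g by (rule nonconst_decreasing_continuous)
  have 0: "0 \<in> {0..pi}" by simp
  \<comment> \<open>The constant is written with cos (0 x), so that its resolvent is an instance of
    the cosine formula.\<close>
  have "neumann_resolvent c (\<lambda>x. g 0 * cos (of_int 0 * x) + (-1) * g x) 0
      = g 0 * neumann_resolvent c (\<lambda>x. cos (of_int 0 * x)) 0 + (-1) * neumann_resolvent c g 0"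
    by (rule neumann_resolvent_lin[OF c _ cg 0]) (intro continuous_intros)
  also have "neumann_resolvent c (\<lambda>x. cos (of_int 0 * x)) 0 = 1 / c"
    by (subst neumann_resolvent_cos[OF c 0]) simp
  finally have 1: "neumann_resolvent c (\<lambda>x. g 0 - g x) 0 = g 0 / c - neumann_resolvent c g 0" by simp
  obtain z where "z \<in> {0..pi}" "g z \<noteq> g 0" using g by (auto simp: nonconst_decreasing_def)
  then have "neumann_resolvent c (\<lambda>x. g 0 - g x) 0 > 0"
    using nonconst_decreasing_le[OF g, of 0] by (intro neumann_resolvent_zero_pos[OF c]) (auto intro!: continuous_intros cg)
  then have "c * neumann_resolvent c g 0 < g 0" using c by (simp add: 1 pos_less_divide_eq mult.commute)
  moreover obtain v where "neumann c g (neumann_resolvent c g) v" by (rule neumann_resolvent_solves[OF c cg])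
  ultimately show thesis by (metis neumann_quadratic_drop that)
qed

text \<open>Maximum principle for v = u'. At an interior maximum of v, v' = c u - g vanishes and v''
  = c v - g' \<le> 0, so c v \<le> g' \<le> 0; at the endpoints v is 0. Nonconstancy comes from the
  drop at 0.\<close>

lemma neumann_resolvent_nonconst_decreasing:
  assumes c: "c > 0" and g: "nonconst_decreasing g"
  shows "nonconst_decreasing (neumann_resolvent c g)"
proof -
  obtain g' where g': "\<And>x. x\<in>{0..pi} \<Longrightarrow> (g has_real_derivative g' x) (at x within {0..pi})"
     "\<And>x. x \<in> {0..pi} \<Longrightarrow> g' x \<le> 0"
    using g unfolding nonconst_decreasing_def by blast
  obtain v where n: "neumann c g (neumann_resolvent c g) v" by (rule neumann_resolvent_solves[OF c nonconst_decreasing_continuous[OF g]])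
  let ?u = "neumann_resolvent c g"
  have u: "(?u has_real_derivative v x) (at x within {0..pi})"
    and v: "(v has_real_derivative c * ?u x - g x) (at x within {0..pi})" if "x \<in> {0..pi}" for x
    using n that by (auto simp: neumann_def)
  have "continuous_on {0..pi} v" by (rule DERIV_continuous_on[OF v])
  then obtain x where x: "x \<in> {0..pi}" and max: "\<And>y. y \<in> {0..pi} \<Longrightarrow> v y \<le> v x"
    using continuous_attains_sup[of "{0..pi}" v] by auto
  have "v x \<le> 0"
  proof (cases "x = 0 \<or> x = pi")
    case True then show ?thesis using n by (auto simp: neumann_def)
  next
    case False
    then have z: "c * ?u x - g x = 0"
      using interior_max_deriv_zero[OF v[OF x] _ _ max] x by auto
    have "((\<lambda>x. c * ?u x - g x) has_real_derivative c * v x - g' x) (at x within {0..pi})"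
      by (intro DERIV_diff DERIV_cmult u g'(1) x)
    from max_second_deriv_nonpos[OF pi_gt_zero v this z x max]
    have "c * v x - g' x \<le> 0" .
    then have "c * v x \<le> 0" using g'(2)[OF x] by simp
    then show ?thesis using c by (simp add: mult_le_0_iff)
  qed
  then have vn: "v y \<le> 0" if "y \<in> {0..pi}" for y using max[OF that] by simp
  obtain e d where ed: "e > 0" "d > 0" "\<And>x. 0 < x \<Longrightarrow> x < d \<Longrightarrow> e * x\<^sup>2 \<le> neumann_resolvent c g 0 - neumann_resolvent c g x"
    by (rule neumann_resolvent_drop[OF c g]) blast
  define z where "z = min (d/2) pi"
  have z: "0 < z" "z < d" "z \<in> {0..pi}" using ed(2) by (auto simp: z_def min_def)
  then have "e * z\<^sup>2 > 0" using ed by simp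
  then have "?u z \<noteq> ?u 0" using ed(3)[OF z(1,2)] by auto
  then show ?thesis unfolding nonconst_decreasing_def using u vn z(3) by blast
qed

section \<open>Powers of the Neumann resolvent\<close>

abbreviation neumann_resolvent_pow :: "nat \<Rightarrow> real \<Rightarrow> (real \<Rightarrow> real) \<Rightarrow> real \<Rightarrow> real" where
  "neumann_resolvent_pow N c \<equiv> neumann_resolvent c ^^ N"

lemma neumann_resolvent_pow_nonconst_decreasing: "c > 0 \<Longrightarrow> nonconst_decreasing g \<Longrightarrow> nonconst_decreasing (neumann_resolvent_pow N c g)"
  by (induction N) (auto intro: neumann_resolvent_nonconst_decreasing)

lemma neumann_resolvent_pow_continuous:
  "c > 0 \<Longrightarrow> continuous_on {0..pi} g \<Longrightarrow> continuous_on {0..pi} (neumann_resolvent_pow N c g)"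
  by (induction N) (auto intro: neumann_resolvent_continuous)

lemma neumann_resolvent_pow_abs_le:
  assumes "c > 0" "continuous_on {0..pi} g" "\<And>x. x \<in> {0..pi} \<Longrightarrow> \<bar>g x\<bar> \<le> B" "y \<in> {0..pi}"
  shows "\<bar>neumann_resolvent_pow N c g y\<bar> \<le> B / c ^ N"
  using assms(4)
proof (induction N arbitrary: y)
  case (Suc N)
  then show ?case
    using neumann_resolvent_abs_le[OF assms(1) neumann_resolvent_pow_continuous[OF assms(1,2), of N], of "B / c ^ N" y]
    by (simp add: mult.commute)
qed (use assms in auto)

lemma neumann_resolvent_pow_lin:
  assumes c: "c > 0" and g: "continuous_on {0..pi} g" and h: "continuous_on {0..pi} h" and y: "y \<in> {0..pi}"
  shows "neumann_resolvent_pow N c (\<lambda>x. a * g x + b * h x) y = a * neumann_resolvent_pow N c g y + b * neumann_resolvent_pow N c h y"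
  using y
proof (induction N arbitrary: y)
  case (Suc N)
  have "continuous_on {0..pi} (\<lambda>x. a * g x + b * h x)" by (intro continuous_intros g h)
  from neumann_resolvent_cong[OF c neumann_resolvent_pow_continuous[OF c this] Suc.IH] Suc.prems
  show ?case using neumann_resolvent_lin[OF c neumann_resolvent_pow_continuous[OF c g, of N] neumann_resolvent_pow_continuous[OF c h, of N]]
    by simp
qed simp

lemma neumann_resolvent_pow_cos:
  assumes c: "c > 0" and y: "y \<in> {0..pi}"
  shows "neumann_resolvent_pow N c (\<lambda>x. cos (of_int n * x)) y = cos (of_int n * y) / (c + (of_int n)\<^sup>2) ^ N"
  using y
proof (induction N arbitrary: y)
  case (Suc N)
  let ?f = "\<lambda>x. cos (of_int n * x) :: real"
  have cf: "continuous_on {0..pi} ?f" by (intro continuous_intros)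
  \<comment> \<open>The N-th power is a multiple of the cosine only on [0,pi], hence the congruence
    lemma; the zero summand gives the multiple the two-term shape of
    \<open>neumann_resolvent_lin\<close>.\<close>
  have "neumann_resolvent_pow (Suc N) c ?f y = neumann_resolvent c (\<lambda>x. 1 / (c + (of_int n)\<^sup>2) ^ N * ?f x + 0 * ?f x) y"
    using neumann_resolvent_cong[OF c neumann_resolvent_pow_continuous[OF c cf] Suc.IH Suc.prems] by simp
  also have "\<dots> = 1 / (c + (of_int n)\<^sup>2) ^ N * neumann_resolvent c ?f y + 0 * neumann_resolvent c ?f y"
    by (rule neumann_resolvent_lin[OF c cf cf Suc.prems])
  also have "\<dots> = ?f y / (c + (of_int n)\<^sup>2) ^ Suc N"
    using neumann_resolvent_cos[OF c Suc.prems, of n] by (simp add: mult.commute)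
  finally show ?case .
qed simp

section \<open>The operator as a mixture of resolvents\<close>

text \<open>Write (a + s)^(-N) as a Gamma integral in t and swap by Tonelli; the s-integral and then
  the t-integral are again Gamma integrals. With a = 1 + \<xi>^2, p = N - \<alpha>/2 and q =
  \<alpha>/2 this is the mixture formula for the symbol.\<close>

lemma nn_integral_beta:
  assumes p: "p > 0" and q: "q > 0" and a: "a > 0" and N: "real N = p + q"
  shows "(\<integral>\<^sup>+s. ennreal (indicator {0<..} s * s powr (p - 1) / (a + s) ^ N) \<partial>lborel)
     = ennreal (Gamma p * Gamma q / Gamma (real N) * a powr - q)"
proof -
  have N0: "real N > 0" using p q N by simp
  then have G: "Gamma (real N) > 0" "Gamma p > 0" "Gamma q > 0" using p q by (auto simp: Gamma_real_pos)
  define F where "F = (\<lambda>s t. ennreal (indicator {0<..} s * s powr (p - 1) *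
      (indicator {0<..} t * t powr (real N - 1) * exp (- (a + s) * t))))"
  have Fm: "case_prod F \<in> borel_measurable (lborel \<Otimes>\<^sub>M lborel)"
    unfolding F_def by measurable
  have 1: "(\<integral>\<^sup>+t. F s t \<partial>lborel) = ennreal (Gamma (real N)) * ennreal (indicator {0<..} s * s powr (p - 1) / (a + s) ^ N)" for s
  proof (cases "s > 0")
    case True
    have "(\<integral>\<^sup>+t. F s t \<partial>lborel) = (\<integral>\<^sup>+t. ennreal (s powr (p - 1)) * ennreal (indicator {0<..} t * t powr (real N - 1) * exp (- (a + s) * t)) \<partial>lborel)"
      using True by (simp add: F_def ennreal_mult')
    also have "\<dots> = ennreal (s powr (p - 1)) * ennreal (Gamma (real N) * (a + s) powr - real N)"
      using nn_integral_powr_exp[OF N0, of "a + s"] True a by (subst nn_integral_cmult) auto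
    also have "(a + s) powr - real N = 1 / (a + s) ^ N"
      using True a by (simp add: powr_minus powr_realpow divide_inverse)
    finally show ?thesis using True a G by (simp add: ennreal_mult[symmetric] mult_ac)
  qed (simp add: F_def)
  have 2: "(\<integral>\<^sup>+s. F s t \<partial>lborel) = ennreal (Gamma p) * ennreal (indicator {0<..} t * t powr (q - 1) * exp (- a * t))" for t
  proof (cases "t > 0")
    case True
    have "exp (- (a + s) * t) = exp (- a * t) * exp (- t * s)" for s
      by (simp add: exp_add[symmetric] algebra_simps)
    then have "(\<integral>\<^sup>+s. F s t \<partial>lborel) = (\<integral>\<^sup>+s. ennreal (t powr (real N - 1) * exp (- a * t)) * ennreal (indicator {0<..} s * s powr (p - 1) * exp (- t * s)) \<partial>lborel)"
      using True by (simp add: F_def ennreal_mult'[symmetric] mult_ac)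
    also have "\<dots> = ennreal (t powr (real N - 1) * exp (- a * t)) * ennreal (Gamma p * t powr - p)"
      using nn_integral_powr_exp[OF p True] by (subst nn_integral_cmult) auto
    also have "\<dots> = ennreal (Gamma p * (t powr (real N - 1) * t powr - p * exp (- a * t)))"
      using G by (simp add: ennreal_mult[symmetric] mult_ac)
    also have "t powr (real N - 1) * t powr - p = t powr (q - 1)"
      by (simp add: powr_add[symmetric] N)
    finally show ?thesis using True G by (simp add: ennreal_mult'[symmetric])
  qed (simp add: F_def)
  have "ennreal (Gamma (real N)) * (\<integral>\<^sup>+s. ennreal (indicator {0<..} s * s powr (p - 1) / (a + s) ^ N) \<partial>lborel)
     = (\<integral>\<^sup>+s. (\<integral>\<^sup>+t. F s t \<partial>lborel) \<partial>lborel)"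
    unfolding 1 by (rule nn_integral_cmult[symmetric]) simp
  also have "\<dots> = (\<integral>\<^sup>+t. (\<integral>\<^sup>+s. F s t \<partial>lborel) \<partial>lborel)"
    by (rule lborel_pair.Fubini'[OF Fm, symmetric])
  also have "\<dots> = ennreal (Gamma p) * ennreal (Gamma q * a powr - q)"
    unfolding 2 using nn_integral_powr_exp[OF q a] by (subst nn_integral_cmult) auto
  finally have "ennreal (1 / Gamma (real N)) * (ennreal (Gamma (real N)) * (\<integral>\<^sup>+s. ennreal (indicator {0<..} s * s powr (p - 1) / (a + s) ^ N) \<partial>lborel))
     = ennreal (1 / Gamma (real N)) * (ennreal (Gamma p) * ennreal (Gamma q * a powr - q))" by simp
  moreover have "ennreal (1 / Gamma (real N)) * ennreal (Gamma (real N)) = 1"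
    using G by (simp add: ennreal_mult[symmetric])
  ultimately show ?thesis using G
    by (simp add: mult.assoc[symmetric] ennreal_mult[symmetric])
qed

lemma has_bochner_integral_beta:
  assumes p: "p > 0" and q: "q > 0" and a: "a > 0" and N: "real N = p + q"
  shows "has_bochner_integral lborel (\<lambda>s. indicator {0<..} s * s powr (p - 1) / (a + s) ^ N)
     (Gamma p * Gamma q / Gamma (real N) * a powr - q)"
proof (rule has_bochner_integral_nn_integral[OF _ _ _ nn_integral_beta[OF assms]])
  show "AE s in lborel. 0 \<le> indicator {0<..} s * s powr (p - 1) / (a + s) ^ N"
    using a by (auto simp: indicator_def)
qed (use assms in \<open>auto simp: Gamma_real_pos less_imp_le\<close>)

text \<open>The map arccos (cos x) folds the line onto [0,pi] by reflection and shifts by multiples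
  of 2 pi, which \<phi> does not see. So \<phi> is a function of cos x, determined by its values on
  [0,pi].\<close>

lemma arccos_cos_even_periodic:
  assumes ev: "\<And>x. \<phi> (- x) = \<phi> x" and per: "periodic_2pi \<phi>"
  shows "\<phi> (arccos (cos x)) = \<phi> x"
proof -
  have p: "\<phi> (x + 2 * pi * real n) = \<phi> x" for x n
  proof (induction n)
    case (Suc n)
    have "\<phi> (x + 2 * pi * real (Suc n)) = \<phi> ((x + 2 * pi * real n) + 2 * pi)"
      by (simp add: algebra_simps)
    then show ?case using per Suc by (simp add: periodic_2pi_def)
  qed simp
  have pz: "\<phi> (x + 2 * pi * of_int n) = \<phi> x" for x n
  proof (cases "n \<ge> 0")
    case True then show ?thesis using p[of x "nat n"] by simp
  next
    case False then show ?thesis using p[of "x + 2 * pi * of_int n" "nat (- n)"] by (simp add: algebra_simps)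
  qed
  have "cos (arccos (cos x)) = cos x" by simp
  then obtain n :: int where "arccos (cos x) = x + 2 * n * pi \<or> arccos (cos x) = - x + 2 * n * pi"
    unfolding cos_eq by (auto elim!: Ints_cases)
  then show ?thesis using pz[of x n] pz[of "- x" n] ev by (auto simp: mult_ac)
qed

text \<open>Weierstrass approximation of \<phi> (arccos y) on [-1,1] makes \<phi> a uniform limit of
  polynomials in cos x, and these are combinations of the functions cos (n x). The density argument
  is packaged as an induction rule.\<close>

lemma even_periodic_induct:
  assumes \<phi>: "continuous_on UNIV \<phi>" "\<And>x. \<phi> (- x) = \<phi> x" "periodic_2pi \<phi>"
    and cos: "\<And>n::int. P (\<lambda>x. cos (of_int n * x))"
    and lin: "\<And>f g a b. P f \<Longrightarrow> P g \<Longrightarrow> P (\<lambda>x. a * f x + b * g x)"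
    and lim: "\<And>f. (\<And>n::nat. P (f n)) \<Longrightarrow> uniform_limit UNIV f \<phi> sequentially \<Longrightarrow> P \<phi>"
  shows "P \<phi>"
proof -
  \<comment> \<open>The factor cos (n x) generalises the claim so that the product-to-sum formula
    closes the induction on k; integer n permits n - 1.\<close>
  have pow: "P (\<lambda>x. cos x ^ k * cos (of_int n * x))" for k and n :: int
  proof (induction k arbitrary: n)
    case (Suc k)
    have "cos x * cos (of_int n * x) = 1 / 2 * cos (of_int (n + 1) * x) + 1 / 2 * cos (of_int (n - 1) * x)" for x :: real
      by (simp add: algebra_simps cos_add cos_diff)
    then have "(\<lambda>x::real. cos x ^ Suc k * cos (of_int n * x)) = (\<lambda>x. 1 / 2 * (cos x ^ k * cos (of_int (n + 1) * x))
         + 1 / 2 * (cos x ^ k * cos (of_int (n - 1) * x)))"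
      by (simp only: power_Suc2 mult.assoc) (simp add: algebra_simps)
    then show ?case using lin[OF Suc[of "n + 1"] Suc[of "n - 1"], of "1/2" "1/2"] by simp
  qed (use cos in simp)
  have pow': "P (\<lambda>x. cos x ^ k)" for k using pow[of k 0] by simp
  have poly: "P (\<lambda>x. \<Sum>i\<le>m. c i * cos x ^ i)" for c and m :: nat
  proof (induction m)
    case 0 then show ?case using lin[OF pow'[of 0] pow'[of 0], of "c 0" 0] by simp
  next
    case (Suc m)
    then show ?case using lin[OF Suc pow'[of "Suc m"], of 1 "c (Suc m)"] by simp
  qed
  have h: "continuous_on {-1..1} (\<lambda>y. \<phi> (arccos y))"
    by (rule continuous_on_compose2[OF \<phi>(1)]) (auto intro!: continuous_intros)
  have "\<exists>f. P f \<and> (\<forall>x. \<bar>\<phi> x - f x\<bar> < 1 / real (Suc n))" for n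
  proof -
    obtain g where g: "polynomial_function g" "\<And>y. y \<in> {-1..1} \<Longrightarrow> norm (\<phi> (arccos y) - g y) < 1 / real (Suc n)"
      using Stone_Weierstrass_polynomial_function[OF compact_Icc h, of "1 / real (Suc n)"] by auto
    from g(1) obtain c m where gc: "g = (\<lambda>x. \<Sum>i\<le>m. c i * x ^ i)"
      unfolding real_polynomial_function_eq[symmetric] real_polynomial_function_iff_sum by blast
    have "\<bar>\<phi> x - (\<Sum>i\<le>m. c i * cos x ^ i)\<bar> < 1 / real (Suc n)" for x
      using g(2)[of "cos x"] arccos_cos_even_periodic[OF \<phi>(2,3), of x] by (simp add: gc)
    then show ?thesis using poly by blast
  qed
  then obtain f where f: "\<And>n. P (f n)" "\<And>n x. \<bar>\<phi> x - f n x\<bar> < 1 / real (Suc n)" by metis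
  have "uniform_limit UNIV f \<phi> sequentially"
  proof (rule uniform_limitI)
    fix e :: real assume "e > 0"
    then obtain n0 where n0: "1 / real (Suc n0) < e" using nat_approx_posE by blast
    have "dist (f n x) (\<phi> x) < e" if "n \<ge> n0" for n x
    proof -
      have "1 / real (Suc n) \<le> 1 / real (Suc n0)" using that by (simp add: frac_le)
      then show ?thesis using f(2)[of x n] n0 by (simp add: dist_real_def abs_minus_commute)
    qed
    then show "\<forall>\<^sub>F n in sequentially. \<forall>x\<in>UNIV. dist (f n x) (\<phi> x) < e"
      by (auto simp: eventually_sequentially)
  qed
  then show ?thesis by (rule lim[OF f(1)])
qed

section \<open>The mixture of resolvents and the functions it represents\<close>

definition resolvent_weight :: "nat \<Rightarrow> real \<Rightarrow> real \<Rightarrow> real" where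
  "resolvent_weight N \<alpha> s = indicator {0<..} s * s powr (real N - \<alpha> / 2 - 1)"

lemma resolvent_weight_nonneg: "resolvent_weight N \<alpha> s \<ge> 0" by (simp add: resolvent_weight_def)

lemma resolvent_weight_zero: "s \<le> 0 \<Longrightarrow> resolvent_weight N \<alpha> s = 0" by (simp add: resolvent_weight_def)

lemma resolvent_weight_measurable [measurable]: "resolvent_weight N \<alpha> \<in> borel_measurable borel"
  unfolding resolvent_weight_def by measurable

text \<open>The Beta function at N - \<alpha>/2 and \<alpha>/2, the reciprocal of the constant in
  front of the mixture formula.\<close>

definition resolvent_const :: "nat \<Rightarrow> real \<Rightarrow> real" where
  "resolvent_const N \<alpha> = Gamma (real N - \<alpha> / 2) * Gamma (\<alpha> / 2) / Gamma (real N)"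

lemma has_bochner_integral_resolvent_weight:
  assumes "0 < \<alpha>" "\<alpha> / 2 < real N"
  shows "has_bochner_integral lborel (\<lambda>s. resolvent_weight N \<alpha> s / (1 + s + \<xi>\<^sup>2) ^ N) (resolvent_const N \<alpha> * symb \<alpha> \<xi>)"
proof -
  have "has_bochner_integral lborel (\<lambda>s. indicator {0<..} s * s powr (real N - \<alpha> / 2 - 1) / (1 + \<xi>\<^sup>2 + s) ^ N)
     (Gamma (real N - \<alpha> / 2) * Gamma (\<alpha> / 2) / Gamma (real N) * (1 + \<xi>\<^sup>2) powr - (\<alpha> / 2))"
    by (rule has_bochner_integral_beta) (use assms in \<open>auto simp: add_pos_nonneg\<close>)
  then show ?thesis by (simp add: resolvent_weight_def resolvent_const_def symb_def add_ac)
qed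

lemma resolvent_weight_integrable:
  assumes "0 < \<alpha>" "\<alpha> / 2 < real N"
  shows "integrable lborel (\<lambda>s. resolvent_weight N \<alpha> s / (1 + s) ^ N)"
  using has_bochner_integral_resolvent_weight[OF assms, of 0] by (simp add: has_bochner_integral_iff)

definition resolvent_mixture :: "nat \<Rightarrow> real \<Rightarrow> (real \<Rightarrow> real) \<Rightarrow> real \<Rightarrow> real \<Rightarrow> real" where
  "resolvent_mixture N \<alpha> f x s = resolvent_weight N \<alpha> s * neumann_resolvent_pow N (1 + s) f x"

text \<open>Each resolvent contributes a factor 1 / (1 + s) to the sup bound. The majorant scales
  with the bound on f, so in \<open>represented_limit\<close> it gives the pointwise convergence and
  also the dominating function.\<close>

lemma resolvent_mixture_abs_le:
  assumes "continuous_on {0..pi} f" "\<And>y. y \<in> {0..pi} \<Longrightarrow> \<bar>f y\<bar> \<le> B" "x \<in> {0..pi}"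
  shows "\<bar>resolvent_mixture N \<alpha> f x s\<bar> \<le> B * (resolvent_weight N \<alpha> s / (1 + s) ^ N)"
proof (cases "s > 0")
  case True
  then have "\<bar>neumann_resolvent_pow N (1 + s) f x\<bar> \<le> B / (1 + s) ^ N"
    by (intro neumann_resolvent_pow_abs_le assms) auto
  then have "resolvent_weight N \<alpha> s * \<bar>neumann_resolvent_pow N (1 + s) f x\<bar> \<le> resolvent_weight N \<alpha> s * (B / (1 + s) ^ N)"
    by (rule mult_left_mono) (rule resolvent_weight_nonneg)
  then show ?thesis by (simp add: resolvent_mixture_def abs_mult resolvent_weight_nonneg mult.commute)
qed (simp add: resolvent_mixture_def resolvent_weight_zero)

lemma resolvent_mixture_lin:
  assumes "continuous_on {0..pi} f" "continuous_on {0..pi} g" "x \<in> {0..pi}"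
  shows "resolvent_mixture N \<alpha> (\<lambda>y. a * f y + b * g y) x s = a * resolvent_mixture N \<alpha> f x s + b * resolvent_mixture N \<alpha> g x s"
proof (cases "s > 0")
  case True
  then show ?thesis unfolding resolvent_mixture_def
    by (subst neumann_resolvent_pow_lin[OF _ assms]) (auto simp: algebra_simps)
qed (simp add: resolvent_mixture_def resolvent_weight_zero)

text \<open>Continuity and boundedness are carried along so that linearity and limits of the
  operator are available at each step of \<open>even_periodic_induct\<close>. The identity is asked
  on [0,pi] only, where the resolvents live.\<close>

definition represented :: "nat \<Rightarrow> real \<Rightarrow> (real \<Rightarrow> real) \<Rightarrow> bool" where
  "represented N \<alpha> f \<longleftrightarrow> continuous_on UNIV f \<and> bounded (range f) \<and>
     (\<forall>x\<in>{0..pi}. has_bochner_integral lborel (resolvent_mixture N \<alpha> f x) (resolvent_const N \<alpha> * L_real \<alpha> f x))"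

text \<open>On cos (n x) both sides are multipliers, (1 + s + n^2)^(-N) under the integral and the
  symbol for the operator, so the claim is the Beta integral at \<xi> = n.\<close>

lemma represented_cos:
  assumes "\<alpha> > 1" "\<alpha> / 2 < real N"
  shows "represented N \<alpha> (\<lambda>x. cos (of_int n * x))"
  unfolding represented_def
proof (intro conjI ballI)
  show "continuous_on UNIV (\<lambda>x. cos (real_of_int n * x))" by (intro continuous_intros)
  show "bounded (range (\<lambda>x. cos (real_of_int n * x)))"
    by (rule boundedI[of _ 1]) auto
  fix x :: real assume x: "x \<in> {0..pi}"
  have "has_bochner_integral lborel (\<lambda>s. resolvent_weight N \<alpha> s / (1 + s + (of_int n)\<^sup>2) ^ N * cos (of_int n * x))
     (resolvent_const N \<alpha> * symb \<alpha> (of_int n) * cos (of_int n * x))"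
    by (intro has_bochner_integral_mult_left has_bochner_integral_resolvent_weight) (use assms in auto)
  moreover have "resolvent_weight N \<alpha> s / (1 + s + (of_int n)\<^sup>2) ^ N * cos (of_int n * x) = resolvent_mixture N \<alpha> (\<lambda>x. cos (of_int n * x)) x s" for s
  proof (cases "s > 0")
    case True
    then show ?thesis unfolding resolvent_mixture_def by (subst neumann_resolvent_pow_cos[OF _ x]) auto
  qed (simp add: resolvent_mixture_def resolvent_weight_zero)
  ultimately show "has_bochner_integral lborel (resolvent_mixture N \<alpha> (\<lambda>x. cos (of_int n * x)) x)
     (resolvent_const N \<alpha> * L_real \<alpha> (\<lambda>x. cos (of_int n * x)) x)"
    using kern_real_cos[OF assms(1)] by (simp add: L_real_def mult.assoc)
qed

lemma represented_lin:
  assumes "\<alpha> > 1" "represented N \<alpha> f" "represented N \<alpha> g"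
  shows "represented N \<alpha> (\<lambda>x. a * f x + b * g x)"
  unfolding represented_def
proof (intro conjI ballI)
  have c: "continuous_on UNIV f" "continuous_on UNIV g" and b: "bounded (range f)" "bounded (range g)"
    using assms by (auto simp: represented_def)
  then show "continuous_on UNIV (\<lambda>x. a * f x + b * g x)" by (intro continuous_intros)
  obtain A B where "\<And>x. \<bar>f x\<bar> \<le> A" "\<And>x. \<bar>g x\<bar> \<le> B" using b by (auto simp: bounded_iff)
  then have "\<bar>a * f x + b * g x\<bar> \<le> \<bar>a\<bar> * A + \<bar>b\<bar> * B" for x
    by (intro order.trans[OF abs_triangle_ineq] add_mono) (auto simp: abs_mult intro!: mult_left_mono)
  then show "bounded (range (\<lambda>x. a * f x + b * g x))"
    by (intro boundedI[of _ "\<bar>a\<bar> * A + \<bar>b\<bar> * B"]) auto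
  fix x :: real assume x: "x \<in> {0..pi}"
  have "has_bochner_integral lborel (\<lambda>s. a * resolvent_mixture N \<alpha> f x s + b * resolvent_mixture N \<alpha> g x s)
      (a * (resolvent_const N \<alpha> * L_real \<alpha> f x) + b * (resolvent_const N \<alpha> * L_real \<alpha> g x))"
    using assms x by (intro has_bochner_integral_add has_bochner_integral_mult_right) (auto simp: represented_def)
  moreover have "(\<lambda>s. a * resolvent_mixture N \<alpha> f x s + b * resolvent_mixture N \<alpha> g x s) = resolvent_mixture N \<alpha> (\<lambda>x. a * f x + b * g x) x"
    using resolvent_mixture_lin[OF continuous_on_subset[OF c(1)] continuous_on_subset[OF c(2)] x] by auto
  ultimately show "has_bochner_integral lborel (resolvent_mixture N \<alpha> (\<lambda>x. a * f x + b * g x) x)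
     (resolvent_const N \<alpha> * L_real \<alpha> (\<lambda>x. a * f x + b * g x) x)"
    using L_real_lin[OF assms(1) _ b(1) _ b(2)] c
    by (simp add: borel_measurable_continuous_onI algebra_simps)
qed

text \<open>Dominated convergence on both sides: in s for the mixture, and in y for the
  convolution.\<close>

lemma represented_limit:
  assumes a: "\<alpha> > 1" "\<alpha> / 2 < real N"
    and f: "\<And>n. represented N \<alpha> (f n)" and lim: "uniform_limit UNIV f g sequentially"
  shows "represented N \<alpha> g"
proof -
  have cf: "continuous_on UNIV (f n)" and bf: "bounded (range (f n))" for n
    using f by (auto simp: represented_def)
  have cg: "continuous_on UNIV g"
    by (rule uniform_limit_theorem[OF _ lim]) (use cf in auto)
  obtain n0 where n0: "\<And>n y. n \<ge> n0 \<Longrightarrow> \<bar>f n y - g y\<bar> < 1"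
    using uniform_limitD[OF lim, of 1] by (auto simp: eventually_sequentially dist_real_def)
  obtain A where A: "\<And>y. \<bar>f n0 y\<bar> \<le> A" using bf[of n0] by (auto simp: bounded_iff)
  have Ag: "\<bar>g y\<bar> \<le> A + 1" for y using A[of y] n0[of n0 y] by linarith
  then have bg: "bounded (range g)" by (intro boundedI[of _ "A + 1"]) auto
  have Af: "\<bar>f (n + n0) y\<bar> \<le> A + 2" for n y using Ag[of y] n0[of "n + n0" y] by linarith
  have "has_bochner_integral lborel (resolvent_mixture N \<alpha> g x) (resolvent_const N \<alpha> * L_real \<alpha> g x)" if x: "x \<in> {0..pi}" for x
  proof -
    have hf: "has_bochner_integral lborel (resolvent_mixture N \<alpha> (f n) x) (resolvent_const N \<alpha> * L_real \<alpha> (f n) x)" for n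
      using f x by (auto simp: represented_def)
    then have fm: "resolvent_mixture N \<alpha> (f n) x \<in> borel_measurable lborel" for n
      by (meson borel_measurable_has_bochner_integral)
    have pt: "(\<lambda>n. resolvent_mixture N \<alpha> (f n) x s) \<longlonglongrightarrow> resolvent_mixture N \<alpha> g x s" for s
    proof (rule metric_LIMSEQ_I)
      fix e :: real assume e: "e > 0"
      define K where "K = resolvent_weight N \<alpha> s / (1 + s) ^ N"
      have K: "K \<ge> 0" by (cases "s > 0") (auto simp: K_def resolvent_weight_nonneg resolvent_weight_zero)
      \<comment> \<open>Dividing by \<open>K + 1\<close> instead of \<open>K\<close> covers
        \<open>K = 0\<close> and gives e K / (K + 1) < e.\<close>
      obtain n1 where n1: "\<And>n y. n \<ge> n1 \<Longrightarrow> \<bar>f n y - g y\<bar> < e / (K + 1)"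
        using uniform_limitD[OF lim, of "e / (K + 1)"] e K
        by (auto simp: eventually_sequentially dist_real_def)
      have "dist (resolvent_mixture N \<alpha> (f n) x s) (resolvent_mixture N \<alpha> g x s) < e" if "n \<ge> n1" for n
      proof -
        have cfn: "continuous_on {0..pi} (f n)" and cg': "continuous_on {0..pi} g"
          using cf cg continuous_on_subset by blast+
        have "\<bar>resolvent_mixture N \<alpha> (\<lambda>y. 1 * f n y + (-1) * g y) x s\<bar> \<le> e / (K + 1) * K"
          unfolding K_def
          by (rule resolvent_mixture_abs_le[OF _ _ x])
             (use n1[OF that] in \<open>auto intro!: continuous_intros cfn cg' less_imp_le simp: K_def\<close>)
        also have "\<dots> < e" using e K by (simp add: pos_divide_less_eq)
        finally show ?thesis unfolding resolvent_mixture_lin[OF cfn cg' x] by (simp add: dist_real_def)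
      qed
      then show "\<exists>n1. \<forall>n\<ge>n1. dist (resolvent_mixture N \<alpha> (f n) x s) (resolvent_mixture N \<alpha> g x s) < e" by blast
    qed
    \<comment> \<open>Measurability in s is inherited from the approximants, so the dependence of
      the resolvent on s need not be examined directly.\<close>
    have gm: "resolvent_mixture N \<alpha> g x \<in> borel_measurable lborel"
      by (rule borel_measurable_LIMSEQ_real[OF pt fm])
    have w: "integrable lborel (\<lambda>s. (A + 2) * (resolvent_weight N \<alpha> s / (1 + s) ^ N))"
      by (intro integrable_mult_right resolvent_weight_integrable) (use a in auto)
    have b1: "AE s in lborel. norm (resolvent_mixture N \<alpha> (f (n + n0)) x s) \<le> (A + 2) * (resolvent_weight N \<alpha> s / (1 + s) ^ N)" for n
      unfolding real_norm_def
      by (intro AE_I2 resolvent_mixture_abs_le x continuous_on_subset[OF cf] Af) simp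
    have pt': "AE s in lborel. (\<lambda>n. resolvent_mixture N \<alpha> (f (n + n0)) x s) \<longlonglongrightarrow> resolvent_mixture N \<alpha> g x s"
      by (intro AE_I2 LIMSEQ_ignore_initial_segment pt)
    have ig: "integrable lborel (resolvent_mixture N \<alpha> g x)"
      by (rule integrable_dominated_convergence[OF gm fm w pt' b1])
    have "(\<lambda>n. integral\<^sup>L lborel (resolvent_mixture N \<alpha> (f (n + n0)) x)) \<longlonglongrightarrow> integral\<^sup>L lborel (resolvent_mixture N \<alpha> g x)"
      by (rule integral_dominated_convergence[OF gm fm w pt' b1])
    then have "(\<lambda>n. integral\<^sup>L lborel (resolvent_mixture N \<alpha> (f n) x)) \<longlonglongrightarrow> integral\<^sup>L lborel (resolvent_mixture N \<alpha> g x)"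
      by (rule LIMSEQ_offset)
    moreover have "integral\<^sup>L lborel (resolvent_mixture N \<alpha> (f n) x) = resolvent_const N \<alpha> * L_real \<alpha> (f n) x" for n
      using hf by (rule has_bochner_integral_integral_eq)
    moreover have "(\<lambda>n. resolvent_const N \<alpha> * L_real \<alpha> (f n) x) \<longlonglongrightarrow> resolvent_const N \<alpha> * L_real \<alpha> g x"
      by (intro tendsto_intros L_real_uniform_limit a lim bf bg)
         (use cf cg in \<open>auto intro: borel_measurable_continuous_onI\<close>)
    ultimately have "integral\<^sup>L lborel (resolvent_mixture N \<alpha> g x) = resolvent_const N \<alpha> * L_real \<alpha> g x"
      using LIMSEQ_unique by auto
    then show ?thesis using ig by (simp add: has_bochner_integral_iff)
  qed
  then show ?thesis using cg bg by (simp add: represented_def)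
qed

lemma represented_even_periodic:
  assumes "\<alpha> > 1" "\<alpha> / 2 < real N"
    and "continuous_on UNIV \<phi>" "\<And>x. \<phi> (- x) = \<phi> x" "periodic_2pi \<phi>"
  shows "represented N \<alpha> \<phi>"
  by (rule even_periodic_induct[OF assms(3-5)])
     (auto intro: represented_cos represented_lin represented_limit assms)

section \<open>Nonsmoothness at the crest\<close>

theorem theorem4p5:
  fixes \<alpha> \<mu> :: real and \<phi> :: "real \<Rightarrow> real"
  assumes "\<alpha> > 1"
    and "is_solution \<alpha> \<mu> \<phi>"
    and "\<And>x. \<phi> x \<le> \<mu>"
    and "\<And>x. \<phi> (- x) = \<phi> x"
    and "periodic_2pi \<phi>"
    and "antimono_on {0..pi} \<phi>"
    and "\<phi> 0 = \<mu>"
    and "\<not> \<phi> constant_on UNIV"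
  shows "\<phi> \<notin> C1_torus"
proof
  assume "\<phi> \<in> C1_torus"
  then obtain D where D: "\<And>x. (\<phi> has_real_derivative D x) (at x)"
    by (auto simp: C1_torus_def C1_differentiable_on_def has_real_derivative_iff_has_vector_derivative)
  have cont: "continuous_on UNIV \<phi>"
    by (rule DERIV_continuous_on[OF D])
  \<comment> \<open>Folding the line onto [0,pi] shows that \<phi> is nonconstant already
    there.\<close>
  have z: "\<exists>z\<in>{0..pi}. \<phi> z \<noteq> \<phi> 0"
  proof (rule ccontr)
    assume c: "\<not> ?thesis"
    have "\<phi> x = \<phi> 0" for x
    proof -
      have "arccos (cos x) \<in> {0..pi}" using arccos_bounded[of "cos x"] by simp
      then have "\<phi> (arccos (cos x)) = \<phi> 0" using c by blast
      then show ?thesis using arccos_cos_even_periodic[OF assms(4,5), of x] by simp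
    qed
    then show False using assms(8) by (auto simp: constant_on_def)
  qed
  have D0: "D x \<le> 0" if "x \<in> {0..pi}" for x
  proof (rule ccontr)
    assume "\<not> D x \<le> 0"
    then have pos: "D x > 0" by simp
    note der = has_field_derivative_at_within[OF D[of x], of "{0..pi}"]
    show False
    proof (cases "x < pi")
      case True
      obtain d where d: "d > 0" "\<And>h. h > 0 \<Longrightarrow> x + h \<in> {0..pi} \<Longrightarrow> h < d \<Longrightarrow> \<phi> x < \<phi> (x + h)"
        using has_real_derivative_pos_inc_right[OF der pos] by blast
      define h where "h = min (d / 2) (pi - x)"
      have "h > 0" "h < d" "x + h \<in> {0..pi}" using d(1) True that by (auto simp: h_def min_def)
      then show False using d(2)[of h] monotone_onD[OF assms(6), of x "x + h"] that by auto
    next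
      \<comment> \<open>Here x = pi, so the comparison uses points to the left.\<close>
      case False
      obtain d where d: "d > 0" "\<And>h. h > 0 \<Longrightarrow> x - h \<in> {0..pi} \<Longrightarrow> h < d \<Longrightarrow> \<phi> (x - h) < \<phi> x"
        using has_real_derivative_pos_inc_left[OF der pos] by blast
      define h where "h = min (d / 2) pi"
      have "h > 0" "h < d" "x - h \<in> {0..pi}" using d(1) False that by (auto simp: h_def min_def)
      then show False using d(2)[of h] monotone_onD[OF assms(6), of "x - h" x] that by auto
    qed
  qed
  have dec: "nonconst_decreasing \<phi>"
    unfolding nonconst_decreasing_def using D D0 z has_field_derivative_at_within by blast
  have "D 0 = 0"
  proof (rule DERIV_local_max[OF D zero_less_one])
    show "\<forall>y. \<bar>0 - y\<bar> < 1 \<longrightarrow> \<phi> y \<le> \<phi> 0" using assms(3,7) by simp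
  qed
  obtain N0 :: nat where N0: "\<alpha> / 2 < real N0" using reals_Archimedean2 by blast
  \<comment> \<open>\<open>M\<close> counts the resolvents inside the outermost one, which will
    produce the quadratic drop at 0.\<close>
  then obtain M where M: "N0 = Suc M" using assms(1) by (cases N0) auto
  define N where "N = Suc M"
  have N: "\<alpha> / 2 < real N" using N0 M by (simp add: N_def)
  have rep: "represented N \<alpha> \<phi>"
    by (rule represented_even_periodic[OF assms(1) N cont assms(4,5)])
  have Leq: "L_real \<alpha> \<phi> 0 - L_real \<alpha> \<phi> x = (\<mu> - \<phi> x)\<^sup>2 / 2" for x
  proof -
    have "of_real (1/2 * (\<mu> - \<phi> y)\<^sup>2) = complex_of_real (1/2 * \<mu>\<^sup>2) - of_real (L_real \<alpha> \<phi> y)" for y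
      using assms(2) by (simp add: is_solution_def L_of_real[OF assms(1)])
    then have "1/2 * (\<mu> - \<phi> y)\<^sup>2 = 1/2 * \<mu>\<^sup>2 - L_real \<alpha> \<phi> y" for y
      by (simp only: of_real_diff[symmetric] of_real_eq_iff)
    from this[of 0] this[of x] show ?thesis using assms(7) by simp
  qed
  \<comment> \<open>A sequence in (0,pi] tending to 0; the shift to n + 1 keeps its first term at
    pi.\<close>
  define X where "X = (\<lambda>n. pi / real (Suc n))"
  have X: "X n > 0" "X n \<in> {0..pi}" for n by (auto simp: X_def field_simps)
  have X0: "X \<longlonglongrightarrow> 0" unfolding X_def by real_asymp
  \<comment> \<open>Second-order difference quotient of the mixture integrand at the crest. Its
    integral over s will tend to 0, while its lower limit is positive for every s > 0.\<close>
  define d where "d = (\<lambda>n s. (resolvent_mixture N \<alpha> \<phi> 0 s - resolvent_mixture N \<alpha> \<phi> (X n) s) / (X n)\<^sup>2)"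
  have d_eq: "d n s = resolvent_weight N \<alpha> s * ((neumann_resolvent_pow N (1 + s) \<phi> 0 - neumann_resolvent_pow N (1 + s) \<phi> (X n)) / (X n)\<^sup>2)" for n s
    by (simp add: d_def resolvent_mixture_def right_diff_distrib diff_divide_distrib)
  have dnn: "d n s \<ge> 0" for n s
  proof (cases "s > 0")
    case True
    then have "nonconst_decreasing (neumann_resolvent_pow N (1 + s) \<phi>)" by (intro neumann_resolvent_pow_nonconst_decreasing dec) simp
    from nonconst_decreasing_le[OF this, of 0 "X n"] have "neumann_resolvent_pow N (1 + s) \<phi> (X n) \<le> neumann_resolvent_pow N (1 + s) \<phi> 0"
      using X(2)[of n] by simp
    then show ?thesis by (simp add: d_eq resolvent_weight_nonneg)
  qed (simp add: d_eq resolvent_weight_zero)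
  \<comment> \<open>By the representation and the equation, the integral is a fixed multiple of
    (u/x)^2 at x = \<open>X n\<close>, with u = \<mu> - \<phi>.\<close>
  have hd: "has_bochner_integral lborel (d n) (resolvent_const N \<alpha> / 2 * ((\<mu> - \<phi> (X n)) / X n)\<^sup>2)" for n
  proof -
    have "has_bochner_integral lborel (d n) ((resolvent_const N \<alpha> * L_real \<alpha> \<phi> 0 - resolvent_const N \<alpha> * L_real \<alpha> \<phi> (X n)) / (X n)\<^sup>2)"
      unfolding d_def using rep X(2)[of n]
      by (intro has_bochner_integral_divide has_bochner_integral_diff) (auto simp: represented_def)
    also have "(resolvent_const N \<alpha> * L_real \<alpha> \<phi> 0 - resolvent_const N \<alpha> * L_real \<alpha> \<phi> (X n)) / (X n)\<^sup>2 = resolvent_const N \<alpha> / 2 * ((\<mu> - \<phi> (X n)) / X n)\<^sup>2"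
      by (simp only: right_diff_distrib[symmetric] Leq) (simp add: power_divide)
    finally show ?thesis .
  qed
  have dm [measurable]: "d n \<in> borel_measurable lborel" for n
    using hd[of n] by (rule borel_measurable_has_bochner_integral)
  have nn: "(\<integral>\<^sup>+s. ennreal (d n s) \<partial>lborel) = ennreal (resolvent_const N \<alpha> / 2 * ((\<mu> - \<phi> (X n)) / X n)\<^sup>2)" for n
  proof -
    have i: "integrable lborel (d n)"
      and e: "integral\<^sup>L lborel (d n) = resolvent_const N \<alpha> / 2 * ((\<mu> - \<phi> (X n)) / X n)\<^sup>2"
      using hd[of n] unfolding has_bochner_integral_iff by blast+
    show ?thesis unfolding e[symmetric]
      by (rule nn_integral_eq_integral[OF i]) (simp add: dnn)
  qed
  \<comment> \<open>Since \<phi>'(0) = 0, u/x tends to 0 along \<open>X\<close>, and the integrals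
    of \<open>d n\<close> do so too.\<close>
  have "((\<lambda>h. (\<phi> (0 + h) - \<phi> 0) / h) \<longlongrightarrow> 0) (at 0)"
    using D[of 0] \<open>D 0 = 0\<close> by (simp add: DERIV_def)
  then have "(\<lambda>n. (\<phi> (0 + X n) - \<phi> 0) / X n) \<longlonglongrightarrow> 0"
    by (rule filterlim_compose) (use X0 X(1) in \<open>auto simp: filterlim_at intro!: always_eventually less_imp_neq[THEN not_sym]\<close>)
  from tendsto_minus[OF this] have "(\<lambda>n. (\<mu> - \<phi> (X n)) / X n) \<longlonglongrightarrow> 0"
    by (simp add: assms(7) minus_divide_left)
  then have "(\<lambda>n. resolvent_const N \<alpha> / 2 * ((\<mu> - \<phi> (X n)) / X n)\<^sup>2) \<longlonglongrightarrow> resolvent_const N \<alpha> / 2 * 0\<^sup>2"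
    by (intro tendsto_intros)
  then have "(\<lambda>n. \<integral>\<^sup>+s. ennreal (d n s) \<partial>lborel) \<longlonglongrightarrow> ennreal 0"
    unfolding nn by (intro tendsto_ennrealI) simp
  then have "liminf (\<lambda>n. \<integral>\<^sup>+s. ennreal (d n s) \<partial>lborel) = 0"
    using lim_imp_Liminf by force
  \<comment> \<open>Fatou, applicable because monotonicity of the powers made \<open>d n\<close>
    nonnegative: the lower limit of \<open>d n\<close> must vanish for almost every s.\<close>
  moreover have "(\<integral>\<^sup>+s. liminf (\<lambda>n. ennreal (d n s)) \<partial>lborel) \<le> liminf (\<lambda>n. \<integral>\<^sup>+s. ennreal (d n s) \<partial>lborel)"
    by (rule nn_integral_liminf) simp
  ultimately have "(\<integral>\<^sup>+s. liminf (\<lambda>n. ennreal (d n s)) \<partial>lborel) = 0" by simp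
  then have ae: "AE s in lborel. liminf (\<lambda>n. ennreal (d n s)) = 0"
    by (subst (asm) nn_integral_0_iff_AE) simp_all
  \<comment> \<open>The outermost resolvent acts on a nonconstant decreasing function, so its
    quadratic drop bounds \<open>d n s\<close> below by a positive number for all large n.\<close>
  have pos: "liminf (\<lambda>n. ennreal (d n s)) \<noteq> 0" if s: "s > 0" for s
  proof -
    have c: "1 + s > 0" using s by simp
    obtain e r where er: "e > 0" "r > 0" "\<And>x. 0 < x \<Longrightarrow> x < r \<Longrightarrow>
        e * x\<^sup>2 \<le> neumann_resolvent (1 + s) (neumann_resolvent_pow M (1 + s) \<phi>) 0 - neumann_resolvent (1 + s) (neumann_resolvent_pow M (1 + s) \<phi>) x"
      using neumann_resolvent_drop[OF c neumann_resolvent_pow_nonconst_decreasing[OF c dec], of M] by metis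
    have "\<forall>\<^sub>F n in sequentially. X n < r" using order_tendstoD(2)[OF X0 er(2)] .
    then have "\<forall>\<^sub>F n in sequentially. ennreal (resolvent_weight N \<alpha> s * e) \<le> ennreal (d n s)"
    proof eventually_elim
      case (elim n)
      have "e \<le> (neumann_resolvent_pow N (1 + s) \<phi> 0 - neumann_resolvent_pow N (1 + s) \<phi> (X n)) / (X n)\<^sup>2"
        using er(3)[OF X(1) elim] X(1)[of n] by (simp add: N_def pos_le_divide_eq)
      then show ?case unfolding d_eq by (intro ennreal_leI mult_left_mono resolvent_weight_nonneg)
    qed
    then have "ennreal (resolvent_weight N \<alpha> s * e) \<le> liminf (\<lambda>n. ennreal (d n s))"
      by (rule Liminf_bounded)
    moreover have "resolvent_weight N \<alpha> s * e > 0" using s er(1) by (simp add: resolvent_weight_def)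
    ultimately show ?thesis by (metis ennreal_eq_0_iff le_zero_eq not_le)
  qed
  \<comment> \<open>The two facts about the lower limit would make the interval (0,1) a null
    set.\<close>
  from ae have "AE s in lborel. s \<notin> {0::real<..<1}"
    by eventually_elim (use pos in auto)
  moreover have "{s \<in> space lborel. \<not> s \<notin> {0::real<..<1}} = {0<..<1}" by auto
  ultimately have "emeasure lborel {0::real<..<1} = 0"
    using AE_iff_measurable[of "{0<..<1}" lborel "\<lambda>s. s \<notin> {0::real<..<1}"] by simp
  then show False by simp
qed

end
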